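(* Let $G$ be a group, $T$ a spherically homogeneous rooted tree, and $\rho:G\to \mathrm{Aut}~T$ a branch action. Let $\mathcal{L}(G)$ be the structure lattice of $G$ and $\mathrm{Bool}(\partial T)$ the Boolean algebra of clopen subsets of the boundary $\partial T$. Then the map $$\Phi:\mathcal{L}(G)\to \mathrm{Bool}(\partial T),\qquad [H]\mapsto \mathrm{Supp}(H),$$ where $\mathrm{Supp}(H)$ is the set of points of $\partial T$ not fixed by $\rho(H)$, is a well-defined, canonical, $G$-equivariant isomorphism of Boolean algebras, with inverse $$\Phi^{-1}:\mathrm{Bool}(\partial T)\to\mathcal{L}(G),\qquad C\mapsto \Big[\prod_{v\in C}\mathrm{rist}_{\rho(G)}(v)\Big],$$ where the product is the subgroup generated by the groups $\mathrm{rist}_{\rho(G)}(v)$ over all vertices $v$ with $C_v\subseteq C$ (identified with a subgroup of $G$ via the injective map $\rho$).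
   Context: A spherically homogeneous rooted tree $T$ is a rooted tree in which all vertices at the same distance from the root have the same degree; the $n$th level $\mathcal{L}_n$ consists of the vertices at distance $n$ from the root. The boundary $\partial T$ is the set of infinite paths from the root; for a vertex $v$, the cone set $C_v\subseteq\partial T$ is the set of paths through $v$; $\partial T$ carries the topology generated by the cone sets. For a clopen $C\subseteq\partial T$, "$v\in C$" means $C_v\subseteq C$. For $G\le\mathrm{Aut}~T$ and a vertex $v$, $\mathrm{st}_G(v)$ is the stabilizer of $v$ and the rigid vertex stabilizer $\mathrm{rist}_G(v)$ is the subgroup of elements of $\mathrm{st}_G(v)$ whose support (points of $\partial T$ moved) is contained in $C_v$; $\mathrm{Rist}_G(n)=\prod_{v\in\mathcal{L}_n}\mathrm{rist}_G(v)$. $G\le \mathrm{Aut}~T$ is a branch group if it acts transitively on every level and $\mathrm{Rist}_G(n)$ has finite index in $G$ for every $n\ge1$. A branch action is a monomorphism $\rho:G\to\mathrm{Aut}~T$ with $\rho(G)$ a branch group. Structure lattice: $L(G)$ is the set of subnormal subgroups of $G$ whose normalizer has finite index in $G$, a lattice with $H\wedge K=H\cap K$, $H\vee K=\langle H,K\rangle$. For $H,K\in L(G)$ write $H\le_{\mathrm{va}}K$ if $H\le K$ and $H$ contains the commutator subgroup of some finite-index subgroup of $K$; set $H\sim K$ iff $H\cap K\le_{\mathrm{va}}H$ and $H\cap K\le_{\mathrm{va}}K$. This is a congruence and $\mathcal{L}(G)=L(G)/\!\sim$ is a Boolean algebra with $0=[\{1\}]$, $1=[G]$, $[H]\wedge[K]=[H\cap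 K]$, $[H]\vee[K]=[\langle H,K\rangle]$. $G$ acts on $\mathcal{L}(G)$ by $[H]^g=[H^g]$ and on $\mathrm{Bool}(\partial T)$ via $\rho$.
   Formalization: Every vertex of T is assumed to have at least two children; as stated the claim fails for the tree with a single infinite path (G trivial), and single-child levels in a tree with infinitely many branching levels can be collapsed without changing the boundary or G. *)

theory Defs
  imports "HOL-Algebra.Algebra"
begin

text \<open>A spherically homogeneous rooted tree is given by its branching sequence m:
 every vertex of level i has m i children. Vertices are finite lists v with
 v!i < m i; the root is the empty list; the children of v are v @ [x], x < m (length v).\<close>

definition vertex :: "(nat \<Rightarrow> nat) \<Rightarrow> nat list \<Rightarrow> bool" where
  "vertex m v \<longleftrightarrow> (\<forall>i < length v. v ! i < m i)"

definition vertices :: "(nat \<Rightarrow> nat) \<Rightarrow> nat list set" where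
  "vertices m = {v. vertex m v}"

definition level :: "(nat \<Rightarrow> nat) \<Rightarrow> nat \<Rightarrow> nat list set" where
  "level m n = {v. vertex m v \<and> length v = n}"

definition tree_edge :: "nat list \<Rightarrow> nat list \<Rightarrow> bool" where
  "tree_edge u v \<longleftrightarrow> (\<exists>x. v = u @ [x]) \<or> (\<exists>x. u = v @ [x])"

text \<open>Automorphisms of the rooted tree: bijections of the vertex set fixing the root
 and preserving adjacency in both directions (extended by the identity outside the
 vertex set so that they form a group under composition).\<close>
definition is_aut :: "(nat \<Rightarrow> nat) \<Rightarrow> (nat list \<Rightarrow> nat list) \<Rightarrow> bool" where
  "is_aut m a \<longleftrightarrow> bij_betw a (vertices m) (vertices m)
     \<and> (\<forall>v. v \<notin> vertices m \<longrightarrow> a v = v)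
     \<and> a [] = []
     \<and> (\<forall>u\<in>vertices m. \<forall>v\<in>vertices m. tree_edge u v \<longleftrightarrow> tree_edge (a u) (a v))"

definition AutT :: "(nat \<Rightarrow> nat) \<Rightarrow> (nat list \<Rightarrow> nat list) monoid" where
  "AutT m = \<lparr>carrier = {a. is_aut m a}, monoid.mult = (\<lambda>a b. a \<circ> b), one = id\<rparr>"

text \<open>Boundary points (infinite paths from the root) are sequences f with f i < m i.\<close>
definition boundary :: "(nat \<Rightarrow> nat) \<Rightarrow> (nat \<Rightarrow> nat) set" where
  "boundary m = {f. \<forall>i. f i < m i}"

definition pre :: "(nat \<Rightarrow> nat) \<Rightarrow> nat \<Rightarrow> nat list" where
  "pre f n = map f [0..<n]"

definition cone :: "(nat \<Rightarrow> nat) \<Rightarrow> nat list \<Rightarrow> (nat \<Rightarrow> nat) set" where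
  "cone m v = {f \<in> boundary m. pre f (length v) = v}"

definition bd_open :: "(nat \<Rightarrow> nat) \<Rightarrow> (nat \<Rightarrow> nat) set \<Rightarrow> bool" where
  "bd_open m U \<longleftrightarrow> U \<subseteq> boundary m \<and> (\<forall>f\<in>U. \<exists>n. cone m (pre f n) \<subseteq> U)"

definition BoolB :: "(nat \<Rightarrow> nat) \<Rightarrow> (nat \<Rightarrow> nat) set set" where
  "BoolB m = {C. bd_open m C \<and> bd_open m (boundary m - C)}"

definition bnd_act :: "(nat list \<Rightarrow> nat list) \<Rightarrow> (nat \<Rightarrow> nat) \<Rightarrow> (nat \<Rightarrow> nat)" where
  "bnd_act a f = (\<lambda>i. a (pre f (Suc i)) ! i)"

definition bsupp :: "(nat \<Rightarrow> nat) \<Rightarrow> (nat list \<Rightarrow> nat list) \<Rightarrow> (nat \<Rightarrow> nat) set" where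
  "bsupp m a = {f \<in> boundary m. bnd_act a f \<noteq> f}"

definition Supp :: "(nat \<Rightarrow> nat) \<Rightarrow> ('a \<Rightarrow> nat list \<Rightarrow> nat list) \<Rightarrow> 'a set \<Rightarrow> (nat \<Rightarrow> nat) set" where
  "Supp m \<rho> H = {f \<in> boundary m. \<exists>h\<in>H. bnd_act (\<rho> h) f \<noteq> f}"

definition rist :: "('a, 'b) monoid_scheme \<Rightarrow> (nat \<Rightarrow> nat) \<Rightarrow> ('a \<Rightarrow> nat list \<Rightarrow> nat list)
    \<Rightarrow> nat list \<Rightarrow> (nat list \<Rightarrow> nat list) set" where
  "rist G m \<rho> v = {a \<in> \<rho> ` carrier G. a v = v \<and> bsupp m a \<subseteq> cone m v}"

definition rist_pre :: "('a, 'b) monoid_scheme \<Rightarrow> (nat \<Rightarrow> nat) \<Rightarrow> ('a \<Rightarrow> nat list \<Rightarrow> nat list)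
    \<Rightarrow> nat list \<Rightarrow> 'a set" where
  "rist_pre G m \<rho> v = {g \<in> carrier G. \<rho> g \<in> rist G m \<rho> v}"

definition Rist_pre :: "('a, 'b) monoid_scheme \<Rightarrow> (nat \<Rightarrow> nat) \<Rightarrow> ('a \<Rightarrow> nat list \<Rightarrow> nat list)
    \<Rightarrow> nat \<Rightarrow> 'a set" where
  "Rist_pre G m \<rho> n = generate G (\<Union>v\<in>level m n. rist_pre G m \<rho> v)"

definition branch_action :: "('a, 'b) monoid_scheme \<Rightarrow> (nat \<Rightarrow> nat) \<Rightarrow> ('a \<Rightarrow> nat list \<Rightarrow> nat list) \<Rightarrow> bool" where
  "branch_action G m \<rho> \<longleftrightarrow>
     \<rho> \<in> hom G (AutT m) \<and> inj_on \<rho> (carrier G)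
     \<and> (\<forall>n. \<forall>u\<in>level m n. \<forall>v\<in>level m n. \<exists>g\<in>carrier G. \<rho> g u = v)
     \<and> (\<forall>n\<ge>1. finite (rcosets\<^bsub>G\<^esub> (Rist_pre G m \<rho> n)))"

definition PhiInv :: "('a, 'b) monoid_scheme \<Rightarrow> (nat \<Rightarrow> nat) \<Rightarrow> ('a \<Rightarrow> nat list \<Rightarrow> nat list)
    \<Rightarrow> (nat \<Rightarrow> nat) set \<Rightarrow> 'a set" where
  "PhiInv G m \<rho> C = generate G (\<Union>v\<in>{v \<in> vertices m. cone m v \<subseteq> C}. rist_pre G m \<rho> v)"

inductive subnormal :: "('a, 'b) monoid_scheme \<Rightarrow> 'a set \<Rightarrow> bool" for G where
  top: "subnormal G (carrier G)"
| step: "subnormal G K \<Longrightarrow> H \<lhd> (G\<lparr>carrier := K\<rparr>) \<Longrightarrow> subnormal G H"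

definition StrL :: "('a, 'b) monoid_scheme \<Rightarrow> 'a set set" where
  "StrL G = {H. subnormal G H \<and> finite (rcosets\<^bsub>G\<^esub> (normalizer G H))}"

definition va_le :: "('a, 'b) monoid_scheme \<Rightarrow> 'a set \<Rightarrow> 'a set \<Rightarrow> bool" where
  "va_le G H K \<longleftrightarrow> H \<subseteq> K \<and>
     (\<exists>F. subgroup F G \<and> F \<subseteq> K \<and> finite (rcosets\<^bsub>G\<lparr>carrier := K\<rparr>\<^esub> F) \<and> derived G F \<subseteq> H)"

definition va_sim :: "('a, 'b) monoid_scheme \<Rightarrow> 'a set \<Rightarrow> 'a set \<Rightarrow> bool" where
  "va_sim G H K \<longleftrightarrow> va_le G (H \<inter> K) H \<and> va_le G (H \<inter> K) K"

definition conjg :: "('a, 'b) monoid_scheme \<Rightarrow> 'a \<Rightarrow> 'a set \<Rightarrow> 'a set" where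
  "conjg G g H = (\<lambda>h. g \<otimes>\<^bsub>G\<^esub> h \<otimes>\<^bsub>G\<^esub> inv\<^bsub>G\<^esub> g) ` H"

end

theory Submission
  imports Defs
begin

text \<open>Two facts drive the proof. If \<open>h \<in> H\<close> moves the vertex \<open>v\<close> and \<open>a\<close>, \<open>b\<close> lie in the rigid
 stabiliser of \<open>v\<close> and normalise \<open>H\<close>, then \<open>[a, b] = [[a, h], b] \<in> H\<close>, because the conjugate of
 \<open>a\<close> by \<open>h\<close> lives on a disjoint cone. Hence \<open>H\<close> contains the derived subgroups of
 \<open>N(H) \<inter> rist(v)\<close> for all \<open>v\<close> it moves, and by compactness of the boundary finitely many of these
 already determine \<open>H\<close> up to \<open>\<sim>\<close>. Secondly, a subgroup \<open>N\<close> of finite index has boundedly many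
 orbits on the levels, so from some level on an orbit is determined by the orbit of its ancestors;
 therefore every open \<open>N\<close>-invariant set is clopen. This makes supports clopen, and reduces equalities
 of supports to density statements, which hold since no \<open>rist(v)\<close> is virtually abelian.\<close>

section \<open>Rooted trees and their boundaries\<close>

text \<open>The relation \<open>va_le\<close> sees subgroups only up to finite index and derived
  subgroups, whereas supports consist of boundary points. If
  \<open>Supp m \<rho> H \<subseteq> Supp m \<rho> K\<close>, the bridge is a level so deep that
  each of its cones lies inside or outside the support of \<open>K\<close>, and every vertex inside
  is moved by \<open>K\<close>. On that level the groups N(K) \<inter> rist(v) commute with one
  another and generate a subgroup of finite index. An element of \<open>H\<close> in it involves
  only factors over vertices moved by \<open>K\<close>, so commutators of such elements fall into
  \<open>K\<close>. In the opposite direction the obstacle is that virtual containment says nothing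
  about elements of rist(v) outside \<open>H\<close>. The test elements are therefore taken from the
  derived subgroups of N(H) \<inter> rist(v), which do lie in \<open>H\<close>. Meets need
  clopenness too: a point moved by \<open>H\<close> and by \<open>K\<close> is not visibly moved by
  \<open>H \<inter> K\<close>, but points arbitrarily close to it are, and a closed support then
  contains it.\<close>

lemma vertex_append [simp]: "vertex m (u @ [x]) \<longleftrightarrow> vertex m u \<and> x < m (length u)"
  unfolding vertex_def by (auto simp: nth_append less_Suc_eq)

lemma vertex_Nil [simp]: "vertex m []"
  by (simp add: vertex_def)

lemma vertex_take: "vertex m v \<Longrightarrow> vertex m (take n v)"
  by (simp add: vertex_def)

lemma is_aut_vertex: "is_aut m a \<Longrightarrow> vertex m v \<Longrightarrow> vertex m (a v)"
  unfolding is_aut_def vertices_def bij_betw_def by auto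

lemma is_aut_inj: "is_aut m a \<Longrightarrow> inj a"
  unfolding is_aut_def bij_betw_def inj_def by (metis image_eqI inj_onD)

text \<open>Adjacency alone would allow a child to be sent to the parent of \<open>a u\<close>.
  Injectivity excludes this, since by induction that parent is already the image of the parent of
  \<open>u\<close>.\<close>

lemma is_aut_child:
  assumes a: "is_aut m a" and "vertex m (u @ [x])"
  shows "\<exists>y. a (u @ [x]) = a u @ [y]"
  using assms(2)
proof (induction u arbitrary: x rule: rev_induct)
  case Nil
  then have "tree_edge (a []) (a [x])"
    using a Nil unfolding is_aut_def vertices_def tree_edge_def
    by (metis append_Nil mem_Collect_eq vertex_Nil)
  then show ?case
    using a by (auto simp: is_aut_def tree_edge_def)
next
  case (snoc z u)
  let ?w = "u @ [z]"
  have v: "vertex m ?w" "vertex m (?w @ [x])" "vertex m u"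
    using snoc.prems by (metis vertex_append)+
  obtain y where y: "a ?w = a u @ [y]"
    using snoc.IH v by blast
  have "tree_edge (a ?w) (a (?w @ [x]))"
    using a v unfolding is_aut_def vertices_def tree_edge_def by blast
  moreover have "a (?w @ [x]) \<noteq> a u"
  proof
    assume "a (?w @ [x]) = a u"
    then have "?w @ [x] = u"
      using a v unfolding is_aut_def vertices_def bij_betw_def by (auto dest: inj_onD)
    then show False by simp
  qed
  ultimately show ?case
    using y by (auto simp: tree_edge_def)
qed

lemma is_aut_length: "is_aut m a \<Longrightarrow> vertex m v \<Longrightarrow> length (a v) = length v"
proof (induction v rule: rev_induct)
  case Nil then show ?case by (simp add: is_aut_def)
next
  case (snoc x v)
  then show ?case using is_aut_child[of m a v x] by auto
qed

lemma is_aut_take: "is_aut m a \<Longrightarrow> vertex m v \<Longrightarrow> a (take n v) = take n (a v)"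
proof (induction v rule: rev_induct)
  case Nil then show ?case by (simp add: is_aut_def)
next
  case (snoc x v)
  then obtain y where "a (v @ [x]) = a v @ [y]" using is_aut_child by blast
  with snoc show ?case by (cases "n \<le> length v") (auto simp: is_aut_length[of m])
qed

lemma length_pre [simp]: "length (pre f n) = n"
  by (simp add: pre_def)

lemma vertex_pre [simp]: "f \<in> boundary m \<Longrightarrow> vertex m (pre f n)"
  by (auto simp: boundary_def vertex_def pre_def)

lemma take_pre: "take k (pre f n) = pre f (min k n)"
  by (simp add: pre_def take_map min_def)

lemma pre_Suc: "pre f (Suc n) = pre f n @ [f n]"
  by (simp add: pre_def)

lemma pre_eqD: "(\<And>n. pre f n = pre g n) \<Longrightarrow> f = g"
  by (metis ext pre_Suc append1_eq_conv)

text \<open>\<open>bnd_act\<close> keeps only the last letter of each image prefix. Since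
  \<open>a\<close> commutes with truncation, these letters spell the images of all prefixes.\<close>

lemma pre_bnd_act:
  assumes a: "is_aut m a" and f: "f \<in> boundary m"
  shows "pre (bnd_act a f) n = a (pre f n)"
proof (rule nth_equalityI)
  show "length (pre (bnd_act a f) n) = length (a (pre f n))" using a f by (simp add: is_aut_length[of m])
  fix i assume "i < length (pre (bnd_act a f) n)"
  then have i: "i < n" by simp
  have "a (pre f (Suc i)) = take (Suc i) (a (pre f n))"
    using is_aut_take[OF a vertex_pre[OF f], of "Suc i" n] i by (simp add: take_pre min_def)
  then show "pre (bnd_act a f) n ! i = a (pre f n) ! i"
    using i by (simp add: bnd_act_def pre_def)
qed

lemma bnd_act_boundary: "is_aut m a \<Longrightarrow> f \<in> boundary m \<Longrightarrow> bnd_act a f \<in> boundary m"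
  unfolding boundary_def
proof safe
  fix i assume a: "is_aut m a" and f: "\<forall>i. f i < m i"
  then have "f \<in> boundary m" by (simp add: boundary_def)
  then have "vertex m (a (pre f (Suc i)))" "length (a (pre f (Suc i))) = Suc i"
    using a by (simp_all add: is_aut_vertex is_aut_length[of m])
  then show "bnd_act a f i < m i" by (simp add: bnd_act_def vertex_def)
qed

lemma cone_pre: "f \<in> boundary m \<Longrightarrow> f \<in> cone m (pre f n)"
  by (simp add: cone_def)

lemma cone_subset_boundary: "cone m v \<subseteq> boundary m"
  by (auto simp: cone_def)

lemma cone_take: "cone m v \<subseteq> cone m (take n v)"
proof
  fix f assume f: "f \<in> cone m v"
  then have "pre f (length v) = v" by (simp add: cone_def)
  then have "take n v = pre f (min n (length v))" by (metis take_pre)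
  with f show "f \<in> cone m (take n v)" by (auto simp: cone_def min.commute)
qed

lemma cone_pre_mono: "n \<le> k \<Longrightarrow> cone m (pre f k) \<subseteq> cone m (pre f n)"
  using cone_take[of m "pre f k" n] by (simp add: take_pre min_def)

lemma cone_disjoint: "length u = length v \<Longrightarrow> u \<noteq> v \<Longrightarrow> cone m u \<inter> cone m v = {}"
  by (auto simp: cone_def)

lemma cone_nonempty:
  assumes "\<And>i. 0 < m i" "vertex m v"
  shows "cone m v \<noteq> {}"
proof -
  \<comment> \<open>Below \<open>v\<close> the path takes the letter 0, which is available because
    every \<open>m i\<close> is positive.\<close>
  let ?f = "\<lambda>i. if i < length v then v ! i else 0"
  have "pre ?f (length v) = v" by (rule nth_equalityI) (auto simp: pre_def)
  moreover have "?f \<in> boundary m" using assms by (auto simp: boundary_def vertex_def)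
  ultimately show ?thesis by (auto simp: cone_def)
qed

lemma finite_level: "finite (level m n)"
proof -
  have "level m n \<subseteq> {v. set v \<subseteq> (\<Union>i<n. {..<m i}) \<and> length v = n}"
    by (fastforce simp: level_def vertex_def in_set_conv_nth)
  then show ?thesis using finite_lists_length_eq[of "\<Union>i<n. {..<m i}" n]
    by (meson finite_UN finite_lessThan finite_subset)
qed

text \<open>Koenig's lemma.\<close>

lemma tree_compactness:
  assumes mono: "\<And>f n k. f \<in> boundary m \<Longrightarrow> P (pre f n) \<Longrightarrow> n \<le> k \<Longrightarrow> P (pre f k)"
    and hit: "\<And>f. f \<in> boundary m \<Longrightarrow> \<exists>n. P (pre f n)"
  shows "\<exists>n. \<forall>f\<in>boundary m. P (pre f n)"
proof (rule ccontr)
  \<comment> \<open>If all children of \<open>v\<close> are good, the maximum of their finitely many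
    depths serves for \<open>v\<close>. So badness passes to some child, and bad vertices can be
    followed to a path on which \<open>P\<close> never becomes true.\<close>
  define good where "good v \<longleftrightarrow> (\<exists>n. \<forall>f\<in>cone m v. P (pre f n))" for v
  assume "\<not> ?thesis"
  then have root: "\<not> good []" by (simp add: good_def cone_def pre_def)
  have step: "\<exists>x. x < m (length v) \<and> \<not> good (v @ [x])" if "\<not> good v" for v
  proof (rule ccontr)
    assume "\<not> ?thesis"
    then have "\<forall>x<m (length v). \<exists>n. \<forall>f\<in>cone m (v @ [x]). P (pre f n)"
      by (auto simp: good_def)
    then obtain k where k: "\<And>x f. x < m (length v) \<Longrightarrow> f \<in> cone m (v @ [x]) \<Longrightarrow> P (pre f (k x))"
      by metis
    define n where "n = Max (insert 0 (k ` {..<m (length v)}))"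
    have "P (pre f n)" if f: "f \<in> cone m v" for f
    proof -
      have x: "f (length v) < m (length v)" "f \<in> cone m (v @ [f (length v)])"
        using f by (auto simp: cone_def boundary_def pre_Suc)
      have "k (f (length v)) \<le> n" unfolding n_def using x by (intro Max_ge) auto
      then show ?thesis using mono[OF _ k[OF x]] f by (simp add: cone_def)
    qed
    with that show False by (auto simp: good_def)
  qed
  define V where "V = rec_nat [] (\<lambda>_ v. v @ [SOME x. x < m (length v) \<and> \<not> good (v @ [x])])"
  have V0: "V 0 = []" and VS: "V (Suc n) = V n @ [SOME x. x < m (length (V n)) \<and> \<not> good (V n @ [x])]" for n
    by (simp_all add: V_def)
  have V: "\<not> good (V n) \<and> vertex m (V n) \<and> length (V n) = n" for n
  proof (induction n)
    case (Suc n)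
    then show ?case using someI_ex[OF step[of "V n"]] by (simp add: VS)
  qed (simp add: V0 root)
  define f where "f i = V (Suc i) ! i" for i
  have pf: "pre f n = V n" for n
    by (induction n) (use V in \<open>auto simp: V0 VS f_def pre_def nth_append\<close>)
  have fb: "f \<in> boundary m"
    unfolding boundary_def f_def using V unfolding vertex_def by (simp add: less_Suc_eq)
  obtain n where "P (pre f n)" using hit[OF fb] by blast
  then have "good (V n)" unfolding good_def pf[symmetric]
    by (intro exI[of _ n]) (auto simp: cone_def)
  then show False using V by blast
qed

text \<open>Not straddling \<open>C\<close> is inherited by smaller cones, and it occurs along every
  path because \<open>C\<close> and its complement are both open; compactness then makes the depth
  uniform.\<close>

lemma clopen_pure:
  assumes "C \<in> BoolB m"
  shows "\<exists>n. \<forall>f\<in>boundary m. cone m (pre f n) \<subseteq> C \<or> cone m (pre f n) \<inter> C = {}"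
proof (rule tree_compactness)
  fix f assume f: "f \<in> boundary m"
  show "\<exists>n. cone m (pre f n) \<subseteq> C \<or> cone m (pre f n) \<inter> C = {}"
  proof (cases "f \<in> C")
    case True
    then obtain n where "cone m (pre f n) \<subseteq> C"
      using assms unfolding BoolB_def bd_open_def by blast
    then show ?thesis by blast
  next
    case False
    then obtain n where "cone m (pre f n) \<subseteq> boundary m - C"
      using f assms unfolding BoolB_def bd_open_def by blast
    then show ?thesis by blast
  qed
next
  fix f n k
  assume "cone m (pre f n) \<subseteq> C \<or> cone m (pre f n) \<inter> C = {}" "n \<le> k"
  then show "cone m (pre f k) \<subseteq> C \<or> cone m (pre f k) \<inter> C = {}"
    using cone_pre_mono[of n k m f] by blast
qed

lemma BoolB_inside:
  assumes "C \<in> BoolB m" "f \<in> C"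
  shows "\<exists>n. \<forall>k\<ge>n. cone m (pre f k) \<subseteq> C"
proof -
  obtain n where "cone m (pre f n) \<subseteq> C"
    using assms unfolding BoolB_def bd_open_def by blast
  then have "\<forall>k\<ge>n. cone m (pre f k) \<subseteq> C" using cone_pre_mono[of n _ m f] by blast
  then show ?thesis ..
qed

lemma BoolB_outside:
  assumes "C \<in> BoolB m" "f \<in> boundary m" "f \<notin> C"
  shows "\<exists>n. \<forall>k\<ge>n. cone m (pre f k) \<inter> C = {}"
proof -
  obtain n where "cone m (pre f n) \<subseteq> boundary m - C"
    using assms unfolding BoolB_def bd_open_def by blast
  then have "\<forall>k\<ge>n. cone m (pre f k) \<inter> C = {}" using cone_pre_mono[of n _ m f] by blast
  then show ?thesis ..
qed

lemma cone_nth: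
  assumes "f \<in> cone m v" "k < length v"
  shows "f k = v ! k"
proof -
  have "pre f (length v) ! k = f k" using assms(2) by (simp add: pre_def)
  then show ?thesis using assms(1) by (simp add: cone_def)
qed

lemma cone_append: "cone m (v @ u) \<subseteq> cone m v"
  using cone_take[of m "v @ u" "length v"] by simp

text \<open>A crude bound with two uses: levels outgrow every finite group, and they are
  nonempty.\<close>

lemma card_level:
  assumes "\<And>i. 2 \<le> m i"
  shows "n < card (level m n)"
proof (induction n)
  case 0
  have "level m 0 = {[]}" by (auto simp: level_def)
  then show ?case by simp
next
  case (Suc n)
  let ?h = "\<lambda>(v, x). v @ [x]"
  have "inj_on ?h (level m n \<times> {0, Suc 0})" by (auto simp: inj_on_def)
  moreover have "?h ` (level m n \<times> {0, Suc 0}) \<subseteq> level m (Suc n)"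
    using assms[of n] by (auto simp: level_def)
  ultimately have "card (level m n \<times> {0, Suc 0}) \<le> card (level m (Suc n))"
    using card_inj_on_le finite_level by blast
  then show ?case using Suc by (simp add: card_cartesian_product)
qed

section \<open>Finite index and commutators\<close>

text \<open>Counts the cosets of \<open>F\<close> that meet \<open>H\<close>, without asking that
  \<open>F\<close> lie in \<open>H\<close>. For subgroups this says that \<open>F \<inter> H\<close>
  has finite index in \<open>H\<close>, and all indices can be handled inside the one ambient group
  \<open>G\<close>.\<close>

definition finite_index :: "('a, 'b) monoid_scheme \<Rightarrow> 'a set \<Rightarrow> 'a set \<Rightarrow> bool" where
  "finite_index G F H \<longleftrightarrow> finite ((\<lambda>h. F #>\<^bsub>G\<^esub> h) ` H)"

lemma finite_index_iff_rcosets: "finite_index G F H \<longleftrightarrow> finite (rcosets\<^bsub>G\<lparr>carrier := H\<rparr>\<^esub> F)"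
proof -
  have "rcosets\<^bsub>G\<lparr>carrier := H\<rparr>\<^esub> F = (\<lambda>h. F #>\<^bsub>G\<^esub> h) ` H"
    by (auto simp: RCOSETS_def r_coset_def)
  then show ?thesis by (simp add: finite_index_def)
qed

lemma finite_index_carrier: "finite_index G F (carrier G) \<longleftrightarrow> finite (rcosets\<^bsub>G\<^esub> F)"
  by (simp add: finite_index_def RCOSETS_def UNION_singleton_eq_range)

text \<open>The pattern behind most finite-index claims: exhibit an invariant \<open>f\<close> with
  finitely many values that determines the coset \<open>g\<close>.\<close>

lemma finite_image_factor:
  assumes "finite (f ` A)" "\<And>x y. x \<in> A \<Longrightarrow> y \<in> A \<Longrightarrow> f x = f y \<Longrightarrow> g x = g y"
  shows "finite (g ` A)"
proof -
  have "g ` A \<subseteq> (\<lambda>c. g (SOME x. x \<in> A \<and> f x = c)) ` f ` A"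
  proof clarify
    fix x assume x: "x \<in> A"
    then have "(SOME y. y \<in> A \<and> f y = f x) \<in> A \<and> f (SOME y. y \<in> A \<and> f y = f x) = f x"
      by (metis (mono_tags, lifting) someI)
    then have "g x = g (SOME y. y \<in> A \<and> f y = f x)" using assms(2) x by metis
    then show "g x \<in> (\<lambda>c. g (SOME x. x \<in> A \<and> f x = c)) ` f ` A" using x by blast
  qed
  then show ?thesis using assms(1) by (meson finite_imageI finite_subset)
qed

context group
begin

lemma r_coset_eq_iff:
  assumes F: "subgroup F G" and x: "x \<in> carrier G" and y: "y \<in> carrier G"
  shows "F #> x = F #> y \<longleftrightarrow> x \<otimes> inv y \<in> F"
proof
  have sub: "F \<subseteq> carrier G" by (rule subgroup.subset[OF F])
  have xy: "x \<otimes> inv y \<in> carrier G" using x y by simp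
  show "x \<otimes> inv y \<in> F" if "F #> x = F #> y"
    by (rule coset_join1[OF coset_mult_inv2[OF that x y sub] xy F])
  show "F #> x = F #> y" if "x \<otimes> inv y \<in> F"
    by (rule coset_mult_inv1[OF coset_join2[OF xy F that] x y sub])
qed

lemma inv_cancel [simp]:
  assumes "x \<in> carrier G" "y \<in> carrier G"
  shows "x \<otimes> (inv x \<otimes> y) = y" "inv x \<otimes> (x \<otimes> y) = y"
  using assms m_assoc[of x "inv x" y] m_assoc[of "inv x" x y] by simp_all

lemma finite_index_subset: "finite_index G F H \<Longrightarrow> H' \<subseteq> H \<Longrightarrow> finite_index G F H'"
  unfolding finite_index_def by (meson finite_subset image_mono)

lemma finite_index_mono:
  assumes "finite_index G E H" "E \<subseteq> F" "subgroup E G" "subgroup F G" "H \<subseteq> carrier G"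
  shows "finite_index G F H"
  unfolding finite_index_def
proof (rule finite_image_factor)
  show "finite ((\<lambda>h. E #> h) ` H)" using assms(1) by (simp add: finite_index_def)
  fix x y assume "x \<in> H" "y \<in> H"
  then have c: "x \<in> carrier G" "y \<in> carrier G" using assms(5) by auto
  then show "E #> x = E #> y \<Longrightarrow> F #> x = F #> y"
    using assms(2) r_coset_eq_iff[OF assms(3) c] r_coset_eq_iff[OF assms(4) c] by blast
qed

lemma finite_index_Int_self:
  assumes "finite_index G F H" "subgroup F G" "subgroup H G"
  shows "finite_index G (F \<inter> H) H"
  unfolding finite_index_def
proof (rule finite_image_factor)
  show "finite ((\<lambda>h. F #> h) ` H)" using assms(1) by (simp add: finite_index_def)
  fix x y assume xy: "x \<in> H" "y \<in> H"
  then have c: "x \<in> carrier G" "y \<in> carrier G" using subgroup.mem_carrier[OF assms(3)] by auto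
  have "x \<otimes> inv y \<in> H" using xy assms(3) by (simp add: subgroup.m_closed subgroup.m_inv_closed)
  then show "F #> x = F #> y \<Longrightarrow> (F \<inter> H) #> x = (F \<inter> H) #> y"
    using r_coset_eq_iff[OF assms(2) c] r_coset_eq_iff[OF subgroups_Inter_pair[OF assms(2,3)] c] by blast
qed

lemma finite_index_Int:
  assumes "finite_index G E H" "finite_index G F H" "subgroup E G" "subgroup F G" "H \<subseteq> carrier G"
  shows "finite_index G (E \<inter> F) H"
proof -
  have "finite ((\<lambda>h. (E #> h, F #> h)) ` H)"
    using assms(1,2) unfolding finite_index_def
    by (rule finite_subset[rotated, OF finite_cartesian_product]) auto
  then show ?thesis
    unfolding finite_index_def
  proof (rule finite_image_factor)
    fix x y assume xy: "x \<in> H" "y \<in> H"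
    then have c: "x \<in> carrier G" "y \<in> carrier G" using assms(5) by auto
    show "(E #> x, F #> x) = (E #> y, F #> y) \<Longrightarrow> (E \<inter> F) #> x = (E \<inter> F) #> y"
      using r_coset_eq_iff[OF assms(3) c] r_coset_eq_iff[OF assms(4) c]
        r_coset_eq_iff[OF subgroups_Inter_pair[OF assms(3,4)] c] by blast
  qed
qed

text \<open>Choose in \<open>H\<close> one representative \<open>r h\<close> for each coset of
  \<open>B\<close>. Then \<open>A #> h\<close> is the translate by \<open>r h\<close> of the coset
  of \<open>h \<otimes> inv (r h)\<close>, an element of \<open>B\<close>, which leaves finitely
  many possibilities.\<close>

lemma finite_index_trans:
  assumes "finite_index G A B" "finite_index G B H" "subgroup A G" "subgroup B G" "H \<subseteq> carrier G" "A \<subseteq> B"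
  shows "finite_index G A H"
proof -
  define r where "r h = (SOME y. y \<in> H \<and> B #> y = B #> h)" for h
  have r: "r h \<in> H \<and> B #> r h = B #> h" if "h \<in> H" for h
    unfolding r_def using that by (metis (mono_tags, lifting) someI)
  have rr: "B #> h = B #> k \<Longrightarrow> r h = r k" for h k by (simp add: r_def)
  have fr: "finite (r ` H)"
    using assms(2) unfolding finite_index_def by (elim finite_image_factor) (rule rr)
  have "(\<lambda>h. A #> h) ` H \<subseteq> (\<lambda>(c, y). c #> y) ` ((\<lambda>h. A #> h) ` B \<times> r ` H)"
  proof clarify
    fix h assume h: "h \<in> H"
    let ?b = "h \<otimes> inv (r h)"
    have c: "h \<in> carrier G" "r h \<in> carrier G" using h r assms(5) by auto
    have "?b \<in> B" using r[OF h] c r_coset_eq_iff[OF assms(4)] by metis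
    moreover have "A #> h = (A #> ?b) #> r h"
      using c subgroup.subset[OF assms(3)] by (simp add: coset_mult_assoc m_assoc)
    ultimately show "A #> h \<in> (\<lambda>(c, y). c #> y) ` ((\<lambda>h. A #> h) ` B \<times> r ` H)"
      using h by (auto intro!: image_eqI[of _ _ "(A #> ?b, r h)"])
  qed
  then show ?thesis
    using assms(1) fr unfolding finite_index_def by (meson finite_SigmaI finite_imageI finite_subset)
qed

lemma set_mult_mem: "b \<in> B \<Longrightarrow> d \<in> D \<Longrightarrow> b \<otimes> d \<in> B <#> D"
  unfolding set_mult_def by blast

text \<open>The coset of \<open>b \<otimes> d\<close> modulo \<open>M\<close> is determined by those
  of \<open>b\<close> modulo \<open>A\<close> and of \<open>d\<close> modulo \<open>C\<close>: in
  the quotient of two products, \<open>d \<otimes> inv d'\<close> has to move past \<open>b\<close>.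
  It lies in \<open>C\<close>, which is why \<open>B\<close> is asked to commute with
  \<open>C\<close> as well as with \<open>D\<close>.\<close>

lemma finite_index_commuting_product:
  assumes sub: "subgroup A G" "subgroup B G" "subgroup C G" "subgroup D G" "subgroup M G"
    and le: "A \<subseteq> M" "C \<subseteq> M"
    and comm: "\<And>b d. b \<in> B \<Longrightarrow> d \<in> C \<union> D \<Longrightarrow> b \<otimes> d = d \<otimes> b"
    and fin: "finite_index G A B" "finite_index G C D"
  shows "finite_index G M (B <#> D)"
proof -
  have eq: "M #> (b \<otimes> d) = M #> (b' \<otimes> d')"
    if "b \<in> B" "b' \<in> B" "d \<in> D" "d' \<in> D" "A #> b = A #> b'" "C #> d = C #> d'" for b b' d d'
  proof -
    have c [simp]: "b \<in> carrier G" "b' \<in> carrier G" "d \<in> carrier G" "d' \<in> carrier G"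
      using that sub subgroup.mem_carrier by metis+
    have a: "b \<otimes> inv b' \<in> A" "d \<otimes> inv d' \<in> C"
      using that sub by (simp_all flip: r_coset_eq_iff)
    have "b \<otimes> d \<otimes> inv (b' \<otimes> d') = b \<otimes> (d \<otimes> inv d') \<otimes> inv b'"
      by (simp add: inv_mult_group m_assoc)
    also have "\<dots> = (d \<otimes> inv d') \<otimes> b \<otimes> inv b'"
      using comm[of b "d \<otimes> inv d'"] that(1) a(2) by simp
    also have "\<dots> = (d \<otimes> inv d') \<otimes> (b \<otimes> inv b')" by (simp add: m_assoc)
    also have "\<dots> \<in> M" using a le sub(5) by (meson subgroup.m_closed subsetD)
    finally show ?thesis using sub(5) by (simp add: r_coset_eq_iff)
  qed
  have "finite ((\<lambda>(b,d). (A #> b, C #> d)) ` (B \<times> D))"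
    using fin unfolding finite_index_def
    by (rule finite_subset[rotated, OF finite_cartesian_product]) auto
  then have "finite ((\<lambda>(b,d). M #> (b \<otimes> d)) ` (B \<times> D))"
    by (rule finite_image_factor) (clarsimp, rule eq, simp_all)
  moreover have "(\<lambda>h. M #> h) ` (B <#> D) = (\<lambda>(b,d). M #> (b \<otimes> d)) ` (B \<times> D)"
    unfolding set_mult_def by force
  ultimately show ?thesis by (simp add: finite_index_def)
qed

lemma commuting_set_mult_subgroup:
  assumes "subgroup B G" "subgroup D G" "\<And>b d. b \<in> B \<Longrightarrow> d \<in> D \<Longrightarrow> b \<otimes> d = d \<otimes> b"
  shows "subgroup (B <#> D) G"
proof (rule subgroupI)
  have c: "B \<subseteq> carrier G" "D \<subseteq> carrier G" using assms(1,2) subgroup.subset by auto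
  show "B <#> D \<subseteq> carrier G" using c by (rule set_mult_closed)
  show "B <#> D \<noteq> {}" using set_mult_mem subgroup.one_closed assms(1,2) by blast
next
  fix x assume "x \<in> B <#> D"
  then obtain b d where x: "b \<in> B" "d \<in> D" "x = b \<otimes> d" unfolding set_mult_def by blast
  then have "inv x = inv b \<otimes> inv d"
    using assms(3)[OF x(1,2)] assms(1,2) by (simp add: subgroup.mem_carrier inv_mult_group)
  then show "inv x \<in> B <#> D"
    using x assms by (simp add: set_mult_mem subgroup.m_inv_closed)
next
  fix x y assume "x \<in> B <#> D" "y \<in> B <#> D"
  then obtain b d b' d' where x: "b \<in> B" "d \<in> D" "x = b \<otimes> d" and y: "b' \<in> B" "d' \<in> D" "y = b' \<otimes> d'"
    unfolding set_mult_def by blast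
  have c: "b \<in> carrier G" "d \<in> carrier G" "b' \<in> carrier G" "d' \<in> carrier G"
    using x y assms subgroup.mem_carrier by metis+
  have "x \<otimes> y = b \<otimes> (d \<otimes> b') \<otimes> d'" using c x y by (simp add: m_assoc)
  also have "d \<otimes> b' = b' \<otimes> d" using assms(3)[OF y(1) x(2)] by simp
  also have "b \<otimes> (b' \<otimes> d) \<otimes> d' = (b \<otimes> b') \<otimes> (d \<otimes> d')" using c by (simp add: m_assoc)
  finally show "x \<otimes> y \<in> B <#> D"
    using x y assms by (simp add: set_mult_mem subgroup.m_closed)
qed

lemma generate_commute:
  assumes "S \<subseteq> carrier G" "x \<in> carrier G" "\<And>s. s \<in> S \<Longrightarrow> s \<otimes> x = x \<otimes> s" "y \<in> generate G S"
  shows "y \<otimes> x = x \<otimes> y"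
  using assms(4)
proof induction
  case (inv h)
  then have h: "h \<in> carrier G" "h \<otimes> x = x \<otimes> h" using assms by auto
  then have "inv h \<otimes> (x \<otimes> h) \<otimes> inv h = inv h \<otimes> (h \<otimes> x) \<otimes> inv h" by simp
  then show ?case using h(1) assms(2) by (simp add: m_assoc)
next
  case (eng a b)
  have c: "a \<in> carrier G" "b \<in> carrier G"
    using eng generate_in_carrier[OF assms(1)] by auto
  have "a \<otimes> b \<otimes> x = a \<otimes> (x \<otimes> b)" using eng c assms(2) by (simp add: m_assoc)
  also have "\<dots> = x \<otimes> (a \<otimes> b)" using eng c assms(2) by (simp flip: m_assoc)
  finally show ?case .
qed (use assms in auto)

lemma generate_Un_commuting:
  assumes "S \<subseteq> carrier G" "T \<subseteq> carrier G" "\<And>s t. s \<in> S \<Longrightarrow> t \<in> T \<Longrightarrow> s \<otimes> t = t \<otimes> s"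
  shows "generate G (S \<union> T) = generate G S <#> generate G T"
    and "\<And>x y. x \<in> generate G S \<Longrightarrow> y \<in> generate G T \<Longrightarrow> x \<otimes> y = y \<otimes> x"
proof -
  have 1: "x \<otimes> t = t \<otimes> x" if "x \<in> generate G S" "t \<in> T" for x t
    using generate_commute[of S t x] that assms by auto
  show 2: "x \<otimes> y = y \<otimes> x" if "x \<in> generate G S" "y \<in> generate G T" for x y
    using generate_commute[of T x y] that assms 1 generate_in_carrier[OF assms(1) that(1)] by auto
  let ?P = "generate G S <#> generate G T"
  have "subgroup ?P G"
    using commuting_set_mult_subgroup[OF generate_is_subgroup generate_is_subgroup] assms 2 by auto
  moreover have "S \<union> T \<subseteq> ?P"
  proof
    fix x assume "x \<in> S \<union> T"
    then show "x \<in> ?P"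
      using set_mult_mem[of x "generate G S" \<one> "generate G T"] set_mult_mem[of \<one> "generate G S" x "generate G T"]
        assms by (auto simp: generate.incl generate.one)
  qed
  ultimately have "generate G (S \<union> T) \<subseteq> ?P" by (simp add: generate_subgroup_incl)
  moreover have "?P \<subseteq> generate G (S \<union> T)"
    unfolding set_mult_def using mono_generate[of S "S \<union> T"] mono_generate[of T "S \<union> T"]
    by (auto intro!: generate.eng)
  ultimately show "generate G (S \<union> T) = ?P" by blast
qed

section \<open>Commutators and normalisers\<close>

definition commutator :: "'a \<Rightarrow> 'a \<Rightarrow> 'a" where
  "commutator x y = x \<otimes> y \<otimes> inv x \<otimes> inv y"

lemma derived_subset_iff:
  assumes "A \<subseteq> carrier G" "subgroup K G"
  shows "derived G A \<subseteq> K \<longleftrightarrow> (\<forall>x\<in>A. \<forall>y\<in>A. commutator x y \<in> K)"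
proof
  show "derived G A \<subseteq> K \<Longrightarrow> \<forall>x\<in>A. \<forall>y\<in>A. commutator x y \<in> K"
    unfolding derived_def commutator_def by (blast intro: generate.incl)
  show "\<forall>x\<in>A. \<forall>y\<in>A. commutator x y \<in> K \<Longrightarrow> derived G A \<subseteq> K"
    unfolding derived_def commutator_def using assms(2) by (intro generate_subgroup_incl) auto
qed

lemma commutator_in_derived: "x \<in> A \<Longrightarrow> y \<in> A \<Longrightarrow> commutator x y \<in> derived G A"
  unfolding derived_def commutator_def by (blast intro: generate.incl)

lemma normalizer_iff:
  assumes "subgroup H G"
  shows "g \<in> normalizer G H \<longleftrightarrow> g \<in> carrier G \<and> (\<lambda>h. g \<otimes> h \<otimes> inv g) ` H = H"
proof -
  have "g <# H #> inv g = (\<lambda>h. g \<otimes> h \<otimes> inv g) ` H"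
    by (auto simp: l_coset_def r_coset_def)
  then show ?thesis
    using subgroup.subset[OF assms] by (auto simp: normalizer_def stabilizer_def)
qed

lemma normalizer_conj:
  assumes "subgroup H G" "g \<in> normalizer G H" "h \<in> H"
  shows "g \<otimes> h \<otimes> inv g \<in> H"
  using assms normalizer_iff by blast

text \<open>Inclusion of the conjugates is enough because \<open>N\<close> is closed under inverses:
  every \<open>h\<close> is the conjugate by \<open>g\<close> of the element
  \<open>inv g \<otimes> h \<otimes> g\<close> of \<open>H\<close>.\<close>

lemma normalizerI:
  assumes H: "subgroup H G" and N: "subgroup N G"
    and conj: "\<And>g h. g \<in> N \<Longrightarrow> h \<in> H \<Longrightarrow> g \<otimes> h \<otimes> inv g \<in> H"
  shows "N \<subseteq> normalizer G H"
proof
  fix g assume g: "g \<in> N"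
  have "h \<in> (\<lambda>h. g \<otimes> h \<otimes> inv g) ` H" if h: "h \<in> H" for h
  proof (rule image_eqI)
    have c: "g \<in> carrier G" "h \<in> carrier G" using g h H N subgroup.mem_carrier by metis+
    show "h = g \<otimes> (inv g \<otimes> h \<otimes> g) \<otimes> inv g" using c by (simp add: m_assoc)
    show "inv g \<otimes> h \<otimes> g \<in> H"
      using conj[of "inv g" h] g h c N by (simp add: subgroup.m_inv_closed)
  qed
  then show "g \<in> normalizer G H"
    using g conj N H by (auto simp: normalizer_iff subgroup.mem_carrier)
qed

lemma subgroup_normalizer: "subgroup H G \<Longrightarrow> subgroup (normalizer G H) G"
  by (simp add: normalizer_imp_subgroup subgroup.subset)

text \<open>In the quotient of the normaliser by \<open>K\<close> the images of \<open>S\<close>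
  commute pairwise, so they generate an abelian group. The proof avoids the quotient and uses the
  identity [ab, y] = (a [b, y] a^-1) [a, y] together with the invariance of
  \<open>K\<close>.\<close>

lemma derived_generate_subset:
  assumes K: "subgroup K G" and S: "S \<subseteq> normalizer G K"
    and comm: "\<And>x y. x \<in> S \<Longrightarrow> y \<in> S \<Longrightarrow> commutator x y \<in> K"
  shows "derived G (generate G S) \<subseteq> K"
proof -
  let ?N = "normalizer G K"
  have N: "subgroup ?N G" by (rule subgroup_normalizer[OF K])
  have NC: "?N \<subseteq> carrier G" using N subgroup.subset by auto
  have BN: "generate G S \<subseteq> ?N" by (rule generate_subgroup_incl[OF S N])
  have ext: "commutator x y \<in> K"
    if y: "y \<in> ?N" "\<And>s. s \<in> S \<Longrightarrow> commutator s y \<in> K" and x: "x \<in> generate G S" for x y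
    using x
  proof induction
    case one
    then show ?case using y NC subgroup.one_closed[OF K] by (auto simp: commutator_def)
  next
    case (incl h) then show ?case using y by simp
  next
    case (inv h)
    then have h: "h \<in> ?N" using S by auto
    have c: "h \<in> carrier G" "y \<in> carrier G" using h y NC by auto
    have "commutator (inv h) y = inv h \<otimes> inv (commutator h y) \<otimes> inv (inv h)"
      using c by (simp add: commutator_def inv_mult_group m_assoc)
    then show ?case
      using normalizer_conj[OF K subgroup.m_inv_closed[OF N h]] y(2)[OF inv] K
      by (simp add: subgroup.m_inv_closed)
  next
    case (eng a b)
    then have h: "a \<in> ?N" "b \<in> ?N" using BN by auto
    have c: "a \<in> carrier G" "b \<in> carrier G" "y \<in> carrier G" using h y NC by auto
    have "commutator (a \<otimes> b) y = (a \<otimes> commutator b y \<otimes> inv a) \<otimes> commutator a y"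
      using c by (simp add: commutator_def inv_mult_group m_assoc)
    then show ?case
      using normalizer_conj[OF K h(1)] eng K by (simp add: subgroup.m_closed)
  qed
  have flip: "commutator x y \<in> K" if "commutator y x \<in> K" "x \<in> ?N" "y \<in> ?N" for x y
  proof -
    have "commutator x y = inv (commutator y x)"
      using that NC by (auto simp: commutator_def inv_mult_group m_assoc subset_iff)
    then show ?thesis using that K by (simp add: subgroup.m_inv_closed)
  qed
  \<comment> \<open>\<open>ext\<close> only enlarges the left argument. It is applied twice, with
    \<open>flip\<close> in between to reach the right argument.\<close>
  have "commutator x y \<in> K" if "x \<in> generate G S" "y \<in> generate G S" for x y
  proof (rule ext)
    show "y \<in> ?N" using that BN by auto
    show "commutator s y \<in> K" if s: "s \<in> S" for s
    proof (rule flip)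
      show sN: "s \<in> ?N" "y \<in> ?N" using s S that(1) \<open>y \<in> ?N\<close> by auto
      show "commutator y s \<in> K"
        using sN(1) comm[OF _ s] \<open>y \<in> generate G S\<close> by (rule ext)
    qed
  qed (fact that)
  then show ?thesis
    using derived_subset_iff[OF subset_trans[OF BN NC] K] by blast
qed

text \<open>Put e = h a^-1 h^-1. Then ae = [a, h] lies in \<open>H\<close> because \<open>a\<close>
  normalises \<open>H\<close>. As e centralises \<open>b\<close>, [a, b] = [ae, b], and this lies in
  \<open>H\<close> because \<open>b\<close> normalises \<open>H\<close>.\<close>

lemma double_commutator:
  assumes H: "subgroup H G" and h: "h \<in> H" and a: "a \<in> normalizer G H" and b: "b \<in> normalizer G H"
    and comm: "h \<otimes> inv a \<otimes> inv h \<otimes> b = b \<otimes> (h \<otimes> inv a \<otimes> inv h)"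
  shows "commutator a b \<in> H"
proof -
  have c: "h \<in> carrier G" "a \<in> carrier G" "b \<in> carrier G"
    using h a b H by (auto simp: normalizer_iff subgroup.mem_carrier)
  define e where "e = h \<otimes> inv a \<otimes> inv h"
  have ec: "e \<in> carrier G" using c by (simp add: e_def)
  have ae: "a \<otimes> e \<in> H"
  proof -
    have "a \<otimes> e = (a \<otimes> h \<otimes> inv a) \<otimes> inv h" using c by (simp add: e_def m_assoc)
    then show ?thesis using normalizer_conj[OF H a h] h H
      by (simp add: subgroup.m_closed subgroup.m_inv_closed)
  qed
  have "e \<otimes> b \<otimes> inv e = b"
    using comm c ec unfolding e_def[symmetric] by (simp add: m_assoc)
  then have "commutator a b = a \<otimes> (e \<otimes> b \<otimes> inv e) \<otimes> inv a \<otimes> inv b"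
    by (simp add: commutator_def)
  also have "\<dots> = (a \<otimes> e) \<otimes> (b \<otimes> inv (a \<otimes> e) \<otimes> inv b)"
    using c ec by (simp add: inv_mult_group m_assoc)
  also have "\<dots> \<in> H"
    using ae normalizer_conj[OF H b] H by (simp add: subgroup.m_closed subgroup.m_inv_closed)
  finally show ?thesis .
qed

lemma normal_in_subgroup:
  assumes "subgroup K G" "subgroup H G" "H \<subseteq> K" "\<And>x h. x \<in> K \<Longrightarrow> h \<in> H \<Longrightarrow> x \<otimes> h \<otimes> inv x \<in> H"
  shows "H \<lhd> G\<lparr>carrier := K\<rparr>"
proof (rule group.normal_invI)
  show "Group.group (G\<lparr>carrier := K\<rparr>)" using assms(1) by (rule subgroup_imp_group)
  show "subgroup H (G\<lparr>carrier := K\<rparr>)" using assms by (intro subgroup_incl)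
  fix x h assume "x \<in> carrier (G\<lparr>carrier := K\<rparr>)" "h \<in> H"
  then show "x \<otimes>\<^bsub>G\<lparr>carrier := K\<rparr>\<^esub> h \<otimes>\<^bsub>G\<lparr>carrier := K\<rparr>\<^esub> inv\<^bsub>G\<lparr>carrier := K\<rparr>\<^esub> x \<in> H"
    using assms by (simp add: m_inv_consistent)
qed

lemma subnormal_imp_subgroup: "subnormal G H \<Longrightarrow> subgroup H G"
proof (induction rule: subnormal.induct)
  case (step K H)
  then show ?case using incl_subgroup normal_imp_subgroup by blast
qed (rule subgroup_self)

lemma generate_conj:
  assumes S: "S \<subseteq> carrier G" and x: "x \<in> carrier G"
    and conj: "\<And>s. s \<in> S \<Longrightarrow> x \<otimes> s \<otimes> inv x \<in> generate G S" and h: "h \<in> generate G S"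
  shows "x \<otimes> h \<otimes> inv x \<in> generate G S"
  using h
proof induction
  case one
  show ?case using x by (simp add: generate.one)
next
  case (incl h)
  then show ?case by (rule conj)
next
  case (inv h)
  then have "h \<in> carrier G" using S by auto
  then have "x \<otimes> inv h \<otimes> inv x = inv (x \<otimes> h \<otimes> inv x)"
    using x by (simp add: inv_mult_group m_assoc)
  then show ?case using conj[OF inv] generate_m_inv_closed[OF S] by simp
next
  case (eng a b)
  then have "a \<in> carrier G" "b \<in> carrier G" using generate_in_carrier[OF S] by auto
  then have "x \<otimes> (a \<otimes> b) \<otimes> inv x = (x \<otimes> a \<otimes> inv x) \<otimes> (x \<otimes> b \<otimes> inv x)"
    using x by (simp add: m_assoc)
  then show ?case using generate.eng[OF eng.IH] by simp
qed

end

section \<open>Groups of tree automorphisms\<close>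

locale tree_action = group G for G (structure) +
  fixes m :: "nat \<Rightarrow> nat" and \<rho> :: "'a \<Rightarrow> nat list \<Rightarrow> nat list"
  assumes m_ge2: "2 \<le> m i"
    and \<rho>_hom: "\<rho> \<in> hom G (AutT m)"
    and \<rho>_inj: "inj_on \<rho> (carrier G)"
begin

abbreviation act :: "'a \<Rightarrow> (nat \<Rightarrow> nat) \<Rightarrow> nat \<Rightarrow> nat" where
  "act g \<equiv> bnd_act (\<rho> g)"

abbreviation supp :: "'a \<Rightarrow> (nat \<Rightarrow> nat) set" where
  "supp g \<equiv> bsupp m (\<rho> g)"

lemma m_pos [simp]: "0 < m i"
  using m_ge2[of i] by linarith

lemma aut [simp]: "g \<in> carrier G \<Longrightarrow> is_aut m (\<rho> g)"
  using hom_in_carrier[OF \<rho>_hom, of g] by (simp add: AutT_def)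

lemma rho_mult [simp]:
  "g \<in> carrier G \<Longrightarrow> h \<in> carrier G \<Longrightarrow> \<rho> (g \<otimes> h) v = \<rho> g (\<rho> h v)"
  using hom_mult[OF \<rho>_hom, of g h] by (simp add: AutT_def)

lemma rho_one [simp]: "\<rho> \<one> v = v"
proof -
  have "\<rho> \<one> (\<rho> \<one> v) = \<rho> \<one> v" using rho_mult[of \<one> \<one> v, symmetric] by simp
  then show ?thesis by (rule injD[OF is_aut_inj[OF aut[OF one_closed]]])
qed

lemma rho_inv_cancel [simp]:
  assumes "g \<in> carrier G"
  shows "\<rho> (inv g) (\<rho> g v) = v" "\<rho> g (\<rho> (inv g) v) = v"
  using assms by (simp_all flip: rho_mult)

lemma rho_eq_iff [simp]: "g \<in> carrier G \<Longrightarrow> \<rho> g u = \<rho> g v \<longleftrightarrow> u = v"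
  by (metis rho_inv_cancel(1))

lemma vertex_rho [simp]: "g \<in> carrier G \<Longrightarrow> vertex m v \<Longrightarrow> vertex m (\<rho> g v)"
  by (simp add: is_aut_vertex)

lemma length_rho [simp]: "g \<in> carrier G \<Longrightarrow> vertex m v \<Longrightarrow> length (\<rho> g v) = length v"
  by (rule is_aut_length[OF aut])

lemma act_boundary [simp]: "g \<in> carrier G \<Longrightarrow> f \<in> boundary m \<Longrightarrow> act g f \<in> boundary m"
  by (simp add: bnd_act_boundary)

lemma pre_act [simp]: "g \<in> carrier G \<Longrightarrow> f \<in> boundary m \<Longrightarrow> pre (act g f) n = \<rho> g (pre f n)"
  by (rule pre_bnd_act[OF aut])

lemma act_mult [simp]:
  assumes "g \<in> carrier G" "h \<in> carrier G" "f \<in> boundary m"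
  shows "act (g \<otimes> h) f = act g (act h f)"
  using assms by (intro pre_eqD) simp

lemma act_one [simp]: "f \<in> boundary m \<Longrightarrow> act \<one> f = f"
  by (intro pre_eqD) simp

lemma act_inv_cancel [simp]:
  assumes "g \<in> carrier G" "f \<in> boundary m"
  shows "act (inv g) (act g f) = f" "act g (act (inv g) f) = f"
  using assms by (simp_all flip: act_mult)

lemma act_eq_iff [simp]:
  "g \<in> carrier G \<Longrightarrow> f \<in> boundary m \<Longrightarrow> f' \<in> boundary m \<Longrightarrow> act g f = act g f' \<longleftrightarrow> f = f'"
  by (metis act_inv_cancel(1))

lemma vertex_eq_pre: "vertex m v \<Longrightarrow> \<exists>f\<in>boundary m. pre f (length v) = v"
  using cone_nonempty[of m v] by (auto simp: cone_def)

text \<open>The tree has no leaves, so every vertex is a prefix of a boundary point and is fixed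
  too. Outside the vertex set automorphisms are the identity by convention, so
  \<open>\<rho> g\<close> and \<open>\<rho> \<one>\<close> agree as functions.\<close>

lemma faithful:
  assumes g: "g \<in> carrier G" and fx: "\<And>f. f \<in> boundary m \<Longrightarrow> act g f = f"
  shows "g = \<one>"
proof -
  have "\<rho> g v = v" for v
  proof (cases "vertex m v")
    case True
    then obtain f where "f \<in> boundary m" "pre f (length v) = v" using vertex_eq_pre by blast
    then show ?thesis using fx g by (metis pre_act)
  next
    case False
    then show ?thesis using aut[OF g] by (simp add: is_aut_def vertices_def)
  qed
  then have "\<rho> g = \<rho> \<one>" by (simp add: fun_eq_iff)
  then show ?thesis using \<rho>_inj g by (auto dest: inj_onD)
qed

lemma act_cone_iff [simp]:
  assumes "g \<in> carrier G" "f \<in> boundary m" "vertex m v"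
  shows "act g f \<in> cone m (\<rho> g v) \<longleftrightarrow> f \<in> cone m v"
  using assms by (simp add: cone_def)

lemma act_cone_mono:
  assumes "g \<in> carrier G" "vertex m v" "vertex m w"
  shows "cone m (\<rho> g w) \<subseteq> cone m (\<rho> g v) \<longleftrightarrow> cone m w \<subseteq> cone m v"
proof -
  have *: "cone m (\<rho> g w) \<subseteq> cone m (\<rho> g v)" if "cone m w \<subseteq> cone m v" "g \<in> carrier G"
    "vertex m v" "vertex m w" for g w v
  proof
    fix f assume f: "f \<in> cone m (\<rho> g w)"
    then have fb: "f \<in> boundary m" by (simp add: cone_def)
    then have e: "f = act g (act (inv g) f)" using that by simp
    with f that fb have "act (inv g) f \<in> cone m w" using act_cone_iff[of g "act (inv g) f" w] by simp
    then have "act (inv g) f \<in> cone m v" using that by blast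
    then show "f \<in> cone m (\<rho> g v)" using act_cone_iff[of g "act (inv g) f" v] fb that e by simp
  qed
  show ?thesis using *[of w v g] *[of "\<rho> g w" "\<rho> g v" "inv g"] assms by auto
qed

section \<open>Supports of elements and rigid stabilisers\<close>

lemma supp_iff: "f \<in> supp g \<longleftrightarrow> f \<in> boundary m \<and> act g f \<noteq> f"
  by (simp add: bsupp_def)

lemma supp_empty: "g \<in> carrier G \<Longrightarrow> supp g = {} \<Longrightarrow> g = \<one>"
  by (rule faithful) (auto simp: bsupp_def)

lemma supp_one [simp]: "supp \<one> = {}"
  by (auto simp: supp_iff)

lemma supp_inv [simp]: "g \<in> carrier G \<Longrightarrow> supp (inv g) = supp g"
  by (auto simp: supp_iff) (metis act_inv_cancel)+

lemma supp_mult: "g \<in> carrier G \<Longrightarrow> h \<in> carrier G \<Longrightarrow> supp (g \<otimes> h) \<subseteq> supp g \<union> supp h"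
  by (auto simp: supp_iff)

lemma supp_act: "g \<in> carrier G \<Longrightarrow> f \<in> supp g \<Longrightarrow> act g f \<in> supp g"
  by (auto simp: supp_iff)

lemma supp_conj:
  assumes "k \<in> carrier G" "g \<in> carrier G"
  shows "supp (k \<otimes> g \<otimes> inv k) = act k ` supp g"
proof
  show "act k ` supp g \<subseteq> supp (k \<otimes> g \<otimes> inv k)"
    using assms by (auto simp: supp_iff)
  show "supp (k \<otimes> g \<otimes> inv k) \<subseteq> act k ` supp g"
  proof
    fix f assume f: "f \<in> supp (k \<otimes> g \<otimes> inv k)"
    then have fb: "f \<in> boundary m" by (simp add: supp_iff)
    have "act (inv k) f \<in> supp g" using f fb assms by (auto simp: supp_iff)
    then show "f \<in> act k ` supp g" using fb assms by (intro image_eqI[of _ _ "act (inv k) f"]) auto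
  qed
qed

text \<open>Each element preserves its own support. A point moved by one factor and its image are
  therefore both fixed by the other.\<close>

lemma supp_disjoint_commute:
  assumes g: "g \<in> carrier G" and h: "h \<in> carrier G" and dis: "supp g \<inter> supp h = {}"
  shows "g \<otimes> h = h \<otimes> g"
proof -
  have "act (g \<otimes> h) f = act (h \<otimes> g) f" if f: "f \<in> boundary m" for f
  proof (cases "f \<in> supp g")
    case True
    then have "act h f = f" "act h (act g f) = act g f"
      using dis supp_act[OF g True] f g by (auto simp: supp_iff disjoint_iff)
    then show ?thesis using f g h by simp
  next
    case gf: False
    then have e: "act g f = f" using f by (simp add: supp_iff)
    show ?thesis
    proof (cases "f \<in> supp h")
      case True
      then have "act g (act h f) = act h f"
        using dis supp_act[OF h True] act_boundary[OF h f] supp_iff by blast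
      then show ?thesis using f g h e by simp
    next
      case False
      then show ?thesis using f g h e by (simp add: supp_iff)
    qed
  qed
  then have "act ((g \<otimes> h) \<otimes> inv (h \<otimes> g)) f = f" if "f \<in> boundary m" for f
    using that g h act_mult[of "h \<otimes> g" "inv (h \<otimes> g)" f]
    by (metis act_boundary act_inv_cancel(2) act_mult inv_closed m_closed)
  then have "(g \<otimes> h) \<otimes> inv (h \<otimes> g) = \<one>" using g h by (intro faithful) auto
  then show ?thesis using g h by (metis inv_equality inv_inv inv_closed m_closed)
qed

text \<open>If \<open>v\<close> were moved, a point of its cone would lie in the support and be
  carried out of the cone, although the support is invariant under \<open>g\<close>.\<close>

lemma supp_cone_fix:
  assumes g: "g \<in> carrier G" and v: "vertex m v" and le: "supp g \<subseteq> cone m v"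
  shows "\<rho> g v = v"
proof (rule ccontr)
  assume ne: "\<rho> g v \<noteq> v"
  obtain f where f: "f \<in> boundary m" "pre f (length v) = v" using vertex_eq_pre[OF v] by blast
  then have "f \<in> supp g" using ne g by (metis pre_act supp_iff)
  then have "act g f \<in> cone m v" using supp_act[OF g] le by blast
  then show False using f g ne by (simp add: cone_def)
qed

abbreviation R :: "nat list \<Rightarrow> 'a set" where
  "R v \<equiv> rist_pre G m \<rho> v"

lemma rist_iff: "vertex m v \<Longrightarrow> g \<in> R v \<longleftrightarrow> g \<in> carrier G \<and> supp g \<subseteq> cone m v"
  using supp_cone_fix by (auto simp: rist_pre_def rist_def)

lemma rist_carrier: "R v \<subseteq> carrier G"
  by (auto simp: rist_pre_def)

lemma subgroup_supp: "subgroup {g \<in> carrier G. supp g \<subseteq> U} G"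
  using supp_mult by (intro subgroupI) (auto, blast)

lemma subgroup_rist:
  assumes "vertex m v"
  shows "subgroup (R v) G"
proof -
  have "R v = {g \<in> carrier G. supp g \<subseteq> cone m v}" using rist_iff[OF assms] by blast
  then show ?thesis using subgroup_supp by simp
qed

lemma rist_mono: "vertex m v \<Longrightarrow> vertex m w \<Longrightarrow> cone m w \<subseteq> cone m v \<Longrightarrow> R w \<subseteq> R v"
  using rist_iff by blast

lemma rist_conj:
  assumes "vertex m v" "k \<in> carrier G" "g \<in> R v"
  shows "k \<otimes> g \<otimes> inv k \<in> R (\<rho> k v)"
proof -
  have "act k ` supp g \<subseteq> cone m (\<rho> k v)"
    using assms act_cone_iff[of k _ v] by (auto simp: rist_iff supp_iff)
  then show ?thesis using assms by (simp add: rist_iff supp_conj)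
qed

lemma rist_commute:
  assumes "vertex m v" "vertex m w" "cone m v \<inter> cone m w = {}" "a \<in> R v" "b \<in> R w"
  shows "a \<otimes> b = b \<otimes> a"
  using assms by (intro supp_disjoint_commute) (auto simp: rist_iff)

lemma moved_vertex:
  assumes "g \<in> carrier G" "f \<in> supp g"
  shows "\<exists>n. \<forall>k\<ge>n. \<rho> g (pre f k) \<noteq> pre f k"
proof -
  have f: "f \<in> boundary m" "act g f \<noteq> f" using assms by (auto simp: supp_iff)
  then obtain n where n: "pre (act g f) n \<noteq> pre f n" using pre_eqD by blast
  have "\<rho> g (pre f k) \<noteq> pre f k" if "k \<ge> n" for k
  proof
    assume "\<rho> g (pre f k) = pre f k"
    then have "pre (act g f) k = pre f k" using f assms by simp
    then have "take n (pre (act g f) k) = take n (pre f k)" by simp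
    then show False using n that by (simp only: take_pre min_absorb1)
  qed
  then show ?thesis by blast
qed

text \<open>A moved vertex goes to another vertex of its level, whose cone is disjoint. Hence
  everything below it is displaced with it.\<close>

lemma moved_cone:
  assumes g: "g \<in> carrier G" and v: "vertex m v" and mv: "\<rho> g v \<noteq> v" and w: "vertex m w" "cone m w \<subseteq> cone m v"
  shows "\<rho> g w \<noteq> w" and "cone m v \<subseteq> supp g"
proof -
  have dis: "cone m (\<rho> g v) \<inter> cone m v = {}"
    using g v mv by (intro cone_disjoint) simp_all
  have *: "act g f \<noteq> f" if "f \<in> cone m v" for f
    using act_cone_iff[OF g _ v, of f] that dis by (auto simp: cone_def)
  then show "cone m v \<subseteq> supp g" by (auto simp: supp_iff cone_def)
  obtain f where f: "f \<in> cone m w" using cone_nonempty[OF m_pos w(1)] by blast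
  show "\<rho> g w \<noteq> w"
  proof
    assume "\<rho> g w = w"
    then have "cone m w \<subseteq> cone m (\<rho> g v)" using act_cone_mono[OF g v w(1)] w(2) by simp
    then show False using dis f w(2) by blast
  qed
qed

section \<open>Moved vertices and supports of subgroups\<close>

text \<open>Combinatorial form of the support: for a subset of the group, \<open>Supp\<close> is the
  union of the cones of moved vertices. Being a condition on prefixes, it is accessible to
  compactness.\<close>

definition moves :: "'a set \<Rightarrow> nat list \<Rightarrow> bool" where
  "moves H v \<longleftrightarrow> (\<exists>h\<in>H. \<rho> h v \<noteq> v)"

lemma Supp_iff: "f \<in> Supp m \<rho> H \<longleftrightarrow> (\<exists>h\<in>H. f \<in> supp h)"
  by (auto simp: Supp_def supp_iff)

lemma moves_cone: "H \<subseteq> carrier G \<Longrightarrow> vertex m v \<Longrightarrow> vertex m w \<Longrightarrow> cone m w \<subseteq> cone m v \<Longrightarrow> moves H v \<Longrightarrow> moves H w"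
  unfolding moves_def using moved_cone(1) by blast

lemma moves_Supp:
  assumes "H \<subseteq> carrier G" "f \<in> Supp m \<rho> H"
  shows "\<exists>n. \<forall>k\<ge>n. moves H (pre f k)"
proof -
  obtain h where h: "h \<in> H" "f \<in> supp h" using assms(2) Supp_iff by blast
  then obtain n where "\<forall>k\<ge>n. \<rho> h (pre f k) \<noteq> pre f k" using moved_vertex assms(1) by blast
  then show ?thesis using h(1) by (auto simp: moves_def)
qed

lemma moves_Supp_cone:
  assumes "H \<subseteq> carrier G" "vertex m v" "moves H v"
  shows "cone m v \<subseteq> Supp m \<rho> H"
proof -
  obtain h where h: "h \<in> H" "\<rho> h v \<noteq> v" using assms(3) moves_def by blast
  then have "cone m v \<subseteq> supp h" using moved_cone(2)[OF _ assms(2) _ assms(2) order_refl] assms(1) by blast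
  then show ?thesis using h(1) Supp_iff by blast
qed

lemma open_Supp:
  assumes "H \<subseteq> carrier G"
  shows "bd_open m (Supp m \<rho> H)"
  unfolding bd_open_def
proof (intro conjI ballI)
  show "Supp m \<rho> H \<subseteq> boundary m" by (auto simp: Supp_def)
  fix f assume f: "f \<in> Supp m \<rho> H"
  then have "f \<in> boundary m" by (simp add: Supp_def)
  then show "\<exists>n. cone m (pre f n) \<subseteq> Supp m \<rho> H"
    using moves_Supp[OF assms f] moves_Supp_cone[OF assms] by (metis order_refl vertex_pre)
qed

lemma supp_commutator_rist:
  assumes "vertex m v" "a \<in> R v" "b \<in> R v"
  shows "commutator a b \<in> R v"
  using assms subgroup_rist[OF assms(1)] unfolding commutator_def
  by (simp add: subgroup.m_closed subgroup.m_inv_closed)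

text \<open>Conjugation by an \<open>h\<close> that moves \<open>v\<close> carries
  \<open>R v\<close> to the rigid stabiliser of a disjoint cone, which supplies the commutation
  needed for \<open>double_commutator\<close>. \<open>N\<close> is any subgroup of the normaliser,
  so that one derived group can be placed in two subgroups at once.\<close>

lemma derived_le_of_moves:
  assumes H: "subgroup H G" and N: "subgroup N G" "N \<subseteq> normalizer G H" and v: "vertex m v" and mv: "moves H v"
  shows "derived G (N \<inter> R v) \<subseteq> H"
proof -
  obtain h where h: "h \<in> H" "\<rho> h v \<noteq> v" using mv by (auto simp: moves_def)
  have hc: "h \<in> carrier G" using h H subgroup.mem_carrier by metis
  have "commutator a b \<in> H" if a: "a \<in> N \<inter> R v" and b: "b \<in> N \<inter> R v" for a b
  proof (rule double_commutator[OF H h(1)])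
    show "a \<in> normalizer G H" "b \<in> normalizer G H" using a b N by auto
    have "inv a \<in> R v" using a subgroup_rist[OF v] by (simp add: subgroup.m_inv_closed)
    then have "h \<otimes> inv a \<otimes> inv h \<in> R (\<rho> h v)" using rist_conj[OF v hc] by simp
    moreover have "cone m (\<rho> h v) \<inter> cone m v = {}"
      using h v hc by (intro cone_disjoint) simp_all
    ultimately show "h \<otimes> inv a \<otimes> inv h \<otimes> b = b \<otimes> (h \<otimes> inv a \<otimes> inv h)"
      using rist_commute[of "\<rho> h v" v] b v hc by simp
  qed
  then show ?thesis
    using H rist_carrier by (subst derived_subset_iff) auto
qed

end

section \<open>Branch groups\<close>

locale branch_group = tree_action +
  assumes trans: "u \<in> level m n \<Longrightarrow> v \<in> level m n \<Longrightarrow> \<exists>g\<in>carrier G. \<rho> g u = v"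
    and Rist_finite_index: "1 \<le> n \<Longrightarrow> finite_index G (Rist_pre G m \<rho> n) (carrier G)"
begin

section \<open>Rigid stabilisers are nontrivial and not commutative up to finite index\<close>

lemma infinite_carrier: "infinite (carrier G)"
proof
  assume fin: "finite (carrier G)"
  let ?n = "card (carrier G)"
  have card: "?n < card (level m ?n)" by (rule card_level) (rule m_ge2)
  then obtain u where u: "u \<in> level m ?n" by (metis card.empty equals0I not_less_zero)
  then have "level m ?n \<subseteq> (\<lambda>g. \<rho> g u) ` carrier G" using trans by blast
  then have "card (level m ?n) \<le> ?n" by (meson card_image_le card_mono dual_order.trans fin finite_imageI)
  then show False using card by simp
qed

text \<open>Level transitivity makes the rigid stabilisers of one level conjugate. If one were
  trivial, the trivial group would be a level stabiliser \<open>Rist_pre\<close> of finite index,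
  and the group would be finite.\<close>

lemma rist_nontrivial:
  assumes v: "vertex m v"
  shows "\<exists>g\<in>R v. g \<noteq> \<one>"
proof (rule ccontr)
  assume "\<not> ?thesis"
  then have triv: "\<And>g. g \<in> R v \<Longrightarrow> g = \<one>" by blast
  \<comment> \<open>\<open>v\<close> may be the root, whereas finite index is known only from level
    1 on; a child is always in that range.\<close>
  let ?w = "v @ [0]" and ?n = "Suc (length v)"
  have w: "vertex m ?w" using v by simp
  have wtriv: "g = \<one>" if "g \<in> R ?w" for g
    using rist_mono[OF v w cone_append] that triv by blast
  have utriv: "x = \<one>" if u: "u \<in> level m ?n" and x: "x \<in> R u" for u x
  proof -
    have xc: "x \<in> carrier G" using x rist_carrier by blast
    obtain g where g: "g \<in> carrier G" "\<rho> g u = ?w" using trans[OF u, of ?w] w by (auto simp: level_def)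
    then have "g \<otimes> x \<otimes> inv g = \<one>"
      using rist_conj[OF _ g(1) x] u wtriv by (simp add: level_def)
    then have "inv g \<otimes> (g \<otimes> x \<otimes> inv g) \<otimes> g = \<one>" using g by simp
    then show "x = \<one>" using g xc by (simp add: m_assoc)
  qed
  have "Rist_pre G m \<rho> ?n \<subseteq> {\<one>}"
    unfolding Rist_pre_def using utriv by (intro generate_subgroup_incl triv_subgroup) blast
  moreover have "\<one> \<in> Rist_pre G m \<rho> ?n" by (simp add: Rist_pre_def generate.one)
  ultimately have "finite_index G {\<one>} (carrier G)" using Rist_finite_index[of ?n] by (metis le_add1 plus_1_eq_Suc singletonD subset_singletonD empty_iff)
  then have "finite ((\<lambda>g. g) ` carrier G)"
    unfolding finite_index_def by (rule finite_image_factor) (simp add: r_coset_def)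
  then show False using infinite_carrier by simp
qed

text \<open>Pigeonhole on cosets: the vertices \<open>v0\<dots>01\<close> have pairwise disjoint cones, so two of
 the corresponding elements differ by a nontrivial element of \<open>F\<close>.\<close>

lemma finite_index_meets:
  assumes F: "subgroup F G" "finite_index G F H" and v: "vertex m v"
    and S: "\<And>w. vertex m w \<Longrightarrow> cone m w \<subseteq> cone m v \<Longrightarrow>
              subgroup (S w) G \<and> S w \<subseteq> R w \<and> S w \<subseteq> H \<and> S w \<noteq> {\<one>} \<and> S w \<subseteq> S v"
  shows "\<exists>g\<in>F \<inter> S v. g \<noteq> \<one>"
proof -
  define w where "w k = v @ (replicate k 0 @ [Suc 0])" for k
  have wv: "vertex m (w k)" "cone m (w k) \<subseteq> cone m v" for k
  proof -
    have 1: "Suc 0 < m i" for i using m_ge2[of i] by simp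
    show "vertex m (w k)" unfolding w_def vertex_def
    proof (intro allI impI)
      fix i assume i: "i < length (v @ replicate k 0 @ [Suc 0])"
      show "(v @ replicate k 0 @ [Suc 0]) ! i < m i"
        using v 1[of i] m_pos[of i] i by (cases "i < length v + k") (auto simp: nth_append vertex_def not_less)
    qed
    show "cone m (w k) \<subseteq> cone m v" unfolding w_def by (rule cone_append)
  qed
  have dis: "cone m (w i) \<inter> cone m (w j) = {}" if "i < j" for i j
  proof -
    have "f (length v + i) = 1" if "f \<in> cone m (w i)" for f
      using cone_nth[OF that, of "length v + i"] by (simp add: w_def nth_append)
    moreover have "f (length v + i) = 0" if "f \<in> cone m (w j)" for f
      using cone_nth[OF that, of "length v + i"] \<open>i < j\<close> by (simp add: w_def nth_append)
    ultimately show ?thesis by fastforce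
  qed
  have "\<exists>g. g \<in> S (w k) \<and> g \<noteq> \<one>" for k
    using S[OF wv[of k]] subgroup.one_closed by blast
  then obtain g where g: "\<And>k. g k \<in> S (w k)" "\<And>k. g k \<noteq> \<one>" by metis
  have gR: "g k \<in> R (w k)" "g k \<in> H" "g k \<in> S v" for k using g(1)[of k] S[OF wv[of k]] by auto
  have gc: "g k \<in> carrier G" for k using gR rist_carrier by blast
  have "finite (range (\<lambda>k. F #> g k))"
    using F(2) gR(2) unfolding finite_index_def by (elim finite_subset[rotated]) auto
  then have "\<not> inj (\<lambda>k. F #> g k)" using infinite_UNIV_nat finite_imageD by blast
  then obtain i j where ij: "i < j" "F #> g i = F #> g j"
    unfolding inj_def by (metis linorder_neqE_nat)
  have "g i \<otimes> inv g j \<in> F" using ij r_coset_eq_iff[OF F(1) gc gc] by simp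
  moreover have "g i \<otimes> inv g j \<in> S v"
    using gR S[OF v order_refl] by (simp add: subgroup.m_closed subgroup.m_inv_closed)
  moreover have "g i \<otimes> inv g j \<noteq> \<one>"
  proof
    assume "g i \<otimes> inv g j = \<one>"
    then have "g i = g j" using gc by (metis inv_equality inv_inv inv_closed)
    moreover have "supp (g k) \<subseteq> cone m (w k)" for k using gR rist_iff[OF wv(1)] by blast
    ultimately have "supp (g i) \<subseteq> cone m (w i) \<inter> cone m (w j)" by (metis Int_subset_iff)
    then have "supp (g i) = {}" using dis[OF ij(1)] by blast
    then show False using supp_empty gc g(2) by blast
  qed
  ultimately show ?thesis by blast
qed

text \<open>Take a nontrivial \<open>a\<close>, a vertex \<open>w\<close> below \<open>v\<close>
  that it moves, and a nontrivial \<open>b\<close> in \<open>S w\<close>. The conjugate of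
  \<open>b\<close> by \<open>a\<close> lives on the disjoint cone of \<open>\<rho> a w\<close>, so
  it differs from \<open>b\<close>. The family \<open>S\<close> is a parameter because it is used
  both for the rigid stabilisers and for derived subgroups inside a given \<open>H\<close>.\<close>

lemma finite_index_noncommuting:
  assumes F: "subgroup F G" "finite_index G F H" and v: "vertex m v"
    and S: "\<And>w. vertex m w \<Longrightarrow> cone m w \<subseteq> cone m v \<Longrightarrow>
              subgroup (S w) G \<and> S w \<subseteq> R w \<and> S w \<subseteq> H \<and> S w \<noteq> {\<one>}"
    and mono: "\<And>u w. vertex m u \<Longrightarrow> vertex m w \<Longrightarrow> cone m u \<subseteq> cone m w \<Longrightarrow> S u \<subseteq> S w"
  shows "\<exists>a\<in>F \<inter> S v. \<exists>b\<in>F \<inter> S v. commutator a b \<noteq> \<one>"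
proof -
  have meets: "\<exists>g\<in>F \<inter> S w. g \<noteq> \<one>" if w: "vertex m w" "cone m w \<subseteq> cone m v" for w
    using F w(1)
  proof (rule finite_index_meets)
    fix u assume u: "vertex m u" "cone m u \<subseteq> cone m w"
    show "subgroup (S u) G \<and> S u \<subseteq> R u \<and> S u \<subseteq> H \<and> S u \<noteq> {\<one>} \<and> S u \<subseteq> S w"
      using S[OF u(1) subset_trans[OF u(2) w(2)]] mono[OF u(1) w(1) u(2)] by simp
  qed
  obtain a where a: "a \<in> F" "a \<in> S v" "a \<noteq> \<one>"
    using meets[OF v order_refl] by blast
  have aR: "a \<in> R v" "a \<in> carrier G" using a S[OF v order_refl] rist_carrier by auto
  then obtain f where f: "f \<in> supp a" using a supp_empty by blast
  then have fb: "f \<in> boundary m" "f \<in> cone m v" using aR rist_iff[OF v] by (auto simp: supp_iff)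
  obtain n where n: "\<And>k. k \<ge> n \<Longrightarrow> \<rho> a (pre f k) \<noteq> pre f k" using moved_vertex[OF aR(2) f] by blast
  \<comment> \<open>Deep enough to be moved by \<open>a\<close> and to lie at or below
    \<open>v\<close>.\<close>
  define w where "w = pre f (max n (length v))"
  have w: "vertex m w" "\<rho> a w \<noteq> w" using fb n by (auto simp: w_def)
  have wv: "cone m w \<subseteq> cone m v"
    using cone_pre_mono[of "length v" "max n (length v)" m f] fb by (simp add: w_def cone_def)
  obtain b where b: "b \<in> F" "b \<in> S w" "b \<noteq> \<one>"
    using meets[OF w(1) wv] by blast
  have bR: "b \<in> R w" "b \<in> carrier G" "b \<in> S v" using b S[OF w(1) wv] mono[OF w(1) v wv] rist_carrier by auto
  have "commutator a b \<noteq> \<one>"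
  proof
    assume "commutator a b = \<one>"
    then have "commutator a b \<otimes> b = b" using bR by simp
    then have "a \<otimes> b \<otimes> inv a = b" using aR bR by (simp add: commutator_def m_assoc)
    then have "b \<in> R (\<rho> a w)" using rist_conj[OF w(1) aR(2) bR(1)] by simp
    then have "supp b \<subseteq> cone m (\<rho> a w) \<inter> cone m w" using rist_iff bR w aR by auto
    also have "\<dots> = {}" using w aR by (intro cone_disjoint) simp_all
    finally show False using supp_empty bR b by blast
  qed
  then show ?thesis using a b bR by blast
qed

lemma derived_rist_nontrivial:
  assumes E: "subgroup E G" "finite_index G E (carrier G)" and v: "vertex m v"
  shows "derived G (E \<inter> R v) \<noteq> {\<one>}"
proof -
  have "\<exists>a\<in>E \<inter> R v. \<exists>b\<in>E \<inter> R v. commutator a b \<noteq> \<one>"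
    using E v
  proof (rule finite_index_noncommuting)
    fix w assume w: "vertex m w"
    show "subgroup (R w) G \<and> R w \<subseteq> R w \<and> R w \<subseteq> carrier G \<and> R w \<noteq> {\<one>}"
      using subgroup_rist[OF w] rist_carrier rist_nontrivial[OF w] by auto
  qed (rule rist_mono)
  then show ?thesis using commutator_in_derived by (metis singletonD)
qed

section \<open>Orbits on levels and clopen supports\<close>

text \<open>By level transitivity every orbit on a level is the image of a coset
  \<open>N #> g\<close> evaluated at one base vertex, so the index of \<open>N\<close> bounds the
  number of orbits.\<close>

lemma orbits_stabilise:
  assumes N: "subgroup N G" "finite_index G N (carrier G)"
  shows "\<exists>n0. \<forall>n\<ge>n0. \<forall>u\<in>level m n. \<forall>v\<in>level m n. take n0 u = take n0 v \<longrightarrow> (\<exists>g\<in>N. \<rho> g u = v)"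
proof -
  have Nc: "N \<subseteq> carrier G" using N subgroup.subset by auto
  define orb where "orb v = (\<lambda>g. \<rho> g v) ` N" for v
  define Orb where "Orb n = orb ` level m n" for n
  have finOrb: "finite (Orb n)" for n by (simp add: Orb_def finite_level)
  have bound: "card (Orb n) \<le> card ((\<lambda>h. N #> h) ` carrier G)" for n
  proof -
    have "n < card (level m n)" by (rule card_level) (rule m_ge2)
    then obtain v0 where v0: "v0 \<in> level m n" by (metis card.empty equals0I not_less_zero)
    have "Orb n \<subseteq> (\<lambda>c. (\<lambda>x. \<rho> x v0) ` c) ` (\<lambda>h. N #> h) ` carrier G"
    proof
      fix c assume "c \<in> Orb n"
      then obtain v where v: "v \<in> level m n" "c = orb v" by (auto simp: Orb_def)
      obtain g where g: "g \<in> carrier G" "\<rho> g v0 = v" using trans[OF v0 v(1)] by blast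
      then have "c = (\<lambda>x. \<rho> x v0) ` (N #> g)"
        using v(2) Nc by (force simp: orb_def r_coset_def)
      then show "c \<in> (\<lambda>c. (\<lambda>x. \<rho> x v0) ` c) ` (\<lambda>h. N #> h) ` carrier G" using g by blast
    qed
    then show ?thesis using N(2) unfolding finite_index_def
      by (meson card_image_le card_mono dual_order.trans finite_imageI)
  qed
  \<comment> \<open>\<open>n0\<close> is a level with the largest number of orbits. Truncation maps
    the orbits of a deeper level onto those of level \<open>n0\<close>, and maximality turns this
    surjection into a bijection.\<close>
  have "\<exists>x. True \<and> (\<forall>y. True \<longrightarrow> card (Orb y) \<le> card (Orb x))"
    by (rule ex_has_greatest_nat[where k = 0 and b = "Suc (card ((\<lambda>h. N #> h) ` carrier G))"])
       (auto simp: less_Suc_eq_le bound)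
  then obtain n0 where n0: "\<And>n. card (Orb n) \<le> card (Orb n0)" by auto
  have "\<exists>g\<in>N. \<rho> g u = v" if n: "n \<ge> n0" and u: "u \<in> level m n" and v: "v \<in> level m n"
    and uv: "take n0 u = take n0 v" for n u v
  proof -
    define T where "T c = take n0 ` c" for c :: "nat list set"
    have T: "T (orb x) = orb (take n0 x)" if "x \<in> level m n" for x
    proof -
      have "take n0 (\<rho> g x) = \<rho> g (take n0 x)" if "g \<in> N" for g
        using is_aut_take[OF aut, of g x n0] that \<open>x \<in> level m n\<close> Nc by (auto simp: level_def)
      then show ?thesis unfolding T_def orb_def image_image by (intro image_cong) auto
    qed
    \<comment> \<open>Surjectivity holds since every vertex of level \<open>n0\<close> has
      descendants on level \<open>n\<close>.\<close>
    have "Orb n0 \<subseteq> T ` Orb n"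
    proof
      fix c assume "c \<in> Orb n0"
      then obtain x where x: "vertex m x" "length x = n0" "c = orb x" by (auto simp: Orb_def level_def)
      obtain f where f: "f \<in> boundary m" "pre f n0 = x" using vertex_eq_pre[OF x(1)] x(2) by blast
      have l: "pre f n \<in> level m n" using f by (simp add: level_def)
      have "take n0 (pre f n) = x" using f n by (simp add: take_pre min_absorb1)
      then have "c = T (orb (pre f n))" using T[OF l] x by simp
      then show "c \<in> T ` Orb n" using l by (simp add: Orb_def)
    qed
    moreover have "T ` Orb n \<subseteq> Orb n0"
    proof clarify
      fix c assume "c \<in> Orb n"
      then obtain x where x: "x \<in> level m n" "c = orb x" by (auto simp: Orb_def)
      then have "take n0 x \<in> level m n0" using n by (auto simp: level_def vertex_take)
      then show "T c \<in> Orb n0" using T[OF x(1)] x(2) by (simp add: Orb_def)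
    qed
    ultimately have eq: "T ` Orb n = Orb n0" by blast
    have "card (T ` Orb n) = card (Orb n)"
      using n0[of n] eq card_image_le[OF finOrb[of n], of T] by simp
    then have inj: "inj_on T (Orb n)" using finOrb eq_card_imp_inj_on by blast
    have "T (orb u) = T (orb v)" using T[OF u] T[OF v] uv by simp
    then have "orb u = orb v" using inj u v by (auto simp: Orb_def dest: inj_onD)
    moreover have "v \<in> orb v" unfolding orb_def using subgroup.one_closed[OF N(1)]
      by (intro image_eqI[of _ _ \<one>]) auto
    ultimately have "v \<in> orb u" by simp
    then show ?thesis unfolding orb_def by blast
  qed
  then show ?thesis by blast
qed

text \<open>Suppose a point \<open>e\<close> of \<open>U\<close> shares with \<open>f\<close> the
  prefix of length \<open>n0\<close>. At a depth where the cone around \<open>e\<close> lies in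
  \<open>U\<close>, some element of \<open>N\<close> carries the prefix of \<open>e\<close> to that
  of \<open>f\<close>, so invariance puts \<open>f\<close> into \<open>U\<close>. Hence the
  complement contains, around each of its points, the cone of level \<open>n0\<close>.\<close>

lemma open_invariant_clopen:
  assumes N: "subgroup N G" "finite_index G N (carrier G)" and U: "bd_open m U"
    and inv: "\<And>g f. g \<in> N \<Longrightarrow> f \<in> U \<Longrightarrow> act g f \<in> U"
  shows "U \<in> BoolB m"
proof -
  have Nc: "N \<subseteq> carrier G" using N subgroup.subset by auto
  have Ub: "U \<subseteq> boundary m" using U by (simp add: bd_open_def)
  obtain n0 where n0: "\<And>n u v. n \<ge> n0 \<Longrightarrow> u \<in> level m n \<Longrightarrow> v \<in> level m n \<Longrightarrow> take n0 u = take n0 v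
      \<Longrightarrow> \<exists>g\<in>N. \<rho> g u = v"
    using orbits_stabilise[OF N] by blast
  have "cone m (pre f n0) \<inter> U = {}" if f: "f \<in> boundary m" "f \<notin> U" for f
  proof (rule ccontr)
    assume "cone m (pre f n0) \<inter> U \<noteq> {}"
    then obtain e where e: "e \<in> U" "e \<in> boundary m" "pre e n0 = pre f n0" by (auto simp: cone_def)
    obtain k where k: "cone m (pre e k) \<subseteq> U" using U e unfolding bd_open_def by blast
    let ?n = "max k n0"
    obtain g where g: "g \<in> N" "\<rho> g (pre e ?n) = pre f ?n"
      using n0[of ?n "pre e ?n" "pre f ?n"] e f by (auto simp: level_def take_pre)
    then have gc: "g \<in> carrier G" using Nc by auto
    have "act (inv g) f \<in> cone m (pre e ?n)"
      using f gc act_cone_iff[OF gc, of "act (inv g) f" "pre e ?n"] e g cone_pre by simp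
    then have "act (inv g) f \<in> U" using k cone_pre_mono[of k ?n m e] by auto
    then have "act g (act (inv g) f) \<in> U" using inv g by blast
    then show False using f gc by simp
  qed
  then have "cone m (pre f n0) \<subseteq> boundary m - U" if "f \<in> boundary m - U" for f
    using that cone_subset_boundary by blast
  then show ?thesis using U unfolding BoolB_def bd_open_def by blast
qed

lemma Supp_normalizer:
  assumes H: "subgroup H G" and g: "g \<in> normalizer G H" and f: "f \<in> Supp m \<rho> H"
  shows "act g f \<in> Supp m \<rho> H"
proof -
  obtain h where h: "h \<in> H" "f \<in> supp h" using f by (auto simp: Supp_iff)
  have c: "h \<in> carrier G" "g \<in> carrier G" using h g H by (auto simp: normalizer_iff subgroup.mem_carrier)
  have "act g f \<in> supp (g \<otimes> h \<otimes> inv g)" using supp_conj[OF c(2,1)] h by blast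
  then show ?thesis using normalizer_conj[OF H g h(1)] Supp_iff by blast
qed

lemma Supp_clopen:
  assumes H: "subgroup H G" and N: "subgroup N G" "finite_index G N (carrier G)" "N \<subseteq> normalizer G H"
  shows "Supp m \<rho> H \<in> BoolB m"
  using N(1,2)
proof (rule open_invariant_clopen)
  show "bd_open m (Supp m \<rho> H)" by (rule open_Supp[OF subgroup.subset[OF H]])
qed (use Supp_normalizer[OF H] N in blast)

text \<open>A clopen support is compact, so finitely many moved vertices cover it. The alternative
  of a cone missing the support extends the condition to all paths, as the compactness lemma
  requires.\<close>

lemma moves_uniform:
  assumes H: "subgroup H G" and C: "Supp m \<rho> H \<in> BoolB m"
  shows "\<exists>n. \<forall>f\<in>Supp m \<rho> H. \<forall>k\<ge>n. moves H (pre f k)"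
proof -
  have Hc: "H \<subseteq> carrier G" by (rule subgroup.subset[OF H])
  have "\<exists>n. \<forall>f\<in>boundary m. cone m (pre f n) \<inter> Supp m \<rho> H = {} \<or> moves H (pre f n)"
  proof (rule tree_compactness)
    fix f n k
    assume f: "f \<in> boundary m" and "n \<le> k"
      and "cone m (pre f n) \<inter> Supp m \<rho> H = {} \<or> moves H (pre f n)"
    then show "cone m (pre f k) \<inter> Supp m \<rho> H = {} \<or> moves H (pre f k)"
      using moves_cone[OF Hc vertex_pre[OF f] vertex_pre[OF f] cone_pre_mono] cone_pre_mono[of n k m f] by blast
  next
    fix f assume "f \<in> boundary m"
    then show "\<exists>n. cone m (pre f n) \<inter> Supp m \<rho> H = {} \<or> moves H (pre f n)"
      using moves_Supp[OF Hc] BoolB_outside[OF C] by blast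
  qed
  then obtain n where n: "\<And>f. f \<in> boundary m \<Longrightarrow> cone m (pre f n) \<inter> Supp m \<rho> H = {} \<or> moves H (pre f n)"
    by blast
  have "moves H (pre f k)" if f: "f \<in> Supp m \<rho> H" and k: "k \<ge> n" for f k
  proof -
    have fb: "f \<in> boundary m" using f by (simp add: Supp_def)
    then have "moves H (pre f n)" using n f cone_pre by blast
    then show ?thesis using moves_cone[OF Hc vertex_pre[OF fb] vertex_pre[OF fb] cone_pre_mono[OF k]] by blast
  qed
  then show ?thesis by blast
qed

section \<open>Comparison of supports with virtual containment\<close>

text \<open>Rigid stabilisers of distinct vertices of one level commute, so finite index can be
  carried to their product one factor at a time. Stating it for any subset \<open>S\<close> of the
  level makes this an induction.\<close>

lemma finite_index_generate_rist:
  assumes N: "subgroup N G" "finite_index G N (carrier G)" and S: "finite S" "S \<subseteq> level m n"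
  shows "finite_index G (generate G (\<Union>v\<in>S. N \<inter> R v)) (generate G (\<Union>v\<in>S. R v))"
  using S
proof (induction S rule: finite_induct)
  case empty
  then show ?case by (simp add: finite_index_def generate_empty)
next
  case (insert u S)
  let ?A = "N \<inter> R u" and ?C = "generate G (\<Union>v\<in>S. N \<inter> R v)" and ?D = "generate G (\<Union>v\<in>S. R v)"
  let ?M = "generate G (\<Union>v\<in>insert u S. N \<inter> R v)"
  have u: "vertex m u" and Sv: "\<And>v. v \<in> S \<Longrightarrow> vertex m v" using insert.prems by (auto simp: level_def)
  have Rc: "(\<Union>v\<in>S. R v) \<subseteq> carrier G" "(\<Union>v\<in>S. N \<inter> R v) \<subseteq> carrier G"
    "(\<Union>v\<in>insert u S. N \<inter> R v) \<subseteq> carrier G"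
    using rist_carrier by blast+
  have CD: "?C \<subseteq> ?D" by (rule mono_generate) blast
  have comm: "b \<otimes> d = d \<otimes> b" if b: "b \<in> R u" and d: "d \<in> (\<Union>v\<in>S. R v)" for b d
  proof -
    obtain v where v: "v \<in> S" "d \<in> R v" using d by blast
    then have "cone m u \<inter> cone m v = {}"
      using insert.hyps insert.prems by (intro cone_disjoint) (auto simp: level_def)
    then show ?thesis using rist_commute[OF u Sv[OF v(1)]] b v by blast
  qed
  have Ru: "generate G (R u) = R u"
    using generate_subgroup_incl[OF order_refl subgroup_rist[OF u]] by (auto intro: generate.incl)
  have prod: "generate G (R u \<union> (\<Union>v\<in>S. R v)) = generate G (R u) <#> ?D"
    by (rule generate_Un_commuting(1)[OF rist_carrier Rc(1)]) (rule comm)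
  have prod_comm: "x \<otimes> y = y \<otimes> x" if "x \<in> generate G (R u)" "y \<in> ?D" for x y
    by (rule generate_Un_commuting(2)[OF rist_carrier Rc(1) _ that]) (rule comm)
  have "finite_index G ?M (R u <#> ?D)"
  proof (rule finite_index_commuting_product[of ?A "R u" ?C ?D])
    show "subgroup ?A G" "subgroup (R u) G"
      using subgroups_Inter_pair N(1) subgroup_rist[OF u] by auto
    show "subgroup ?C G" "subgroup ?D G" "subgroup ?M G"
      by (rule generate_is_subgroup, rule Rc)+
    show "?A \<subseteq> ?M" by (auto intro: generate.incl)
    show "?C \<subseteq> ?M" by (rule mono_generate) blast
    show "b \<otimes> d = d \<otimes> b" if "b \<in> R u" "d \<in> ?C \<union> ?D" for b d
      using prod_comm[unfolded Ru, OF that(1)] that(2) CD by blast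
    show "finite_index G ?A (R u)"
      by (rule finite_index_Int_self[OF finite_index_subset[OF N(2) rist_carrier] N(1) subgroup_rist[OF u]])
    show "finite_index G ?C ?D" using insert by simp
  qed
  then show ?case using prod by (simp add: Ru)
qed

lemma generate_supp:
  assumes "A \<subseteq> carrier G" "\<And>a. a \<in> A \<Longrightarrow> supp a \<subseteq> U" "x \<in> generate G A"
  shows "supp x \<subseteq> U"
proof -
  have "generate G A \<subseteq> {g \<in> carrier G. supp g \<subseteq> U}"
    by (rule generate_subgroup_incl[OF _ subgroup_supp]) (use assms in auto)
  then show ?thesis using assms(3) by blast
qed

text \<open>A finite-index part of \<open>H\<close> sits in the product of the groups N(K) \<inter>
  R v over one deep level. The inclusion of supports removes the factors outside
  \<open>Supp m \<rho> K\<close>; in the remaining product, commutators within one factor lie in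
  \<open>K\<close> and distinct factors commute.\<close>

lemma derived_le_of_Supp_le:
  assumes H: "subgroup H G" and K: "subgroup K G" "finite_index G (normalizer G K) (carrier G)"
    and le: "Supp m \<rho> H \<subseteq> Supp m \<rho> K"
  shows "\<exists>F. subgroup F G \<and> F \<subseteq> H \<and> finite_index G F H \<and> derived G F \<subseteq> K"
proof -
  let ?C = "Supp m \<rho> K" and ?N = "normalizer G K"
  have N: "subgroup ?N G" by (rule subgroup_normalizer[OF K(1)])
  have C: "?C \<in> BoolB m" by (rule Supp_clopen[OF K(1) N K(2) order_refl])
  obtain n1 where n1: "\<And>f. f \<in> boundary m \<Longrightarrow> cone m (pre f n1) \<subseteq> ?C \<or> cone m (pre f n1) \<inter> ?C = {}"
    using clopen_pure[OF C] by blast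
  obtain n2 where n2: "\<And>f k. f \<in> ?C \<Longrightarrow> k \<ge> n2 \<Longrightarrow> moves K (pre f k)"
    using moves_uniform[OF K(1) C] by blast
  \<comment> \<open>Below \<open>n1\<close> cones do not straddle the support, below
    \<open>n2\<close> its vertices are moved by \<open>K\<close>; the successor gives a level at
    least 1, where \<open>Rist_pre\<close> has finite index.\<close>
  define n where "n = Suc (max n1 n2)"
  define L where "L = level m n"
  define P where "P = {v \<in> L. cone m v \<subseteq> ?C}"
  have L: "vertex m v" "length v = n" if "v \<in> L" for v using that by (auto simp: L_def level_def)
  have PL: "P \<subseteq> L" by (auto simp: P_def)
  have Ppure: "cone m v \<inter> ?C = {}" if v: "v \<in> L - P" for v
  proof -
    obtain f where f: "f \<in> boundary m" "pre f n = v" using vertex_eq_pre L v by (metis DiffD1)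
    have "cone m v \<subseteq> cone m (pre f n1)" using cone_pre_mono[of n1 n m f] f by (simp add: n_def)
    then show ?thesis using n1[OF f(1)] v by (auto simp: P_def)
  qed
  have Pmoves: "moves K v" if v: "v \<in> P" for v
  proof -
    obtain f where f: "f \<in> boundary m" "pre f n = v" using vertex_eq_pre L v PL by (metis subsetD)
    then have "f \<in> ?C" using v cone_pre[of f m n] by (auto simp: P_def)
    then show ?thesis using n2[of f n] f by (simp add: n_def)
  qed
  define gen where "gen S = (\<Union>v\<in>S. ?N \<inter> R v)" for S
  have genc: "gen S \<subseteq> carrier G" for S using rist_carrier by (auto simp: gen_def)
  let ?M = "generate G (gen L)"
  have M: "subgroup ?M G" by (rule generate_is_subgroup[OF genc])
  have MR: "finite_index G ?M (Rist_pre G m \<rho> n)"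
    unfolding Rist_pre_def gen_def L_def by (rule finite_index_generate_rist[OF N K(2) finite_level order_refl])
  have MR': "?M \<subseteq> Rist_pre G m \<rho> n"
    unfolding Rist_pre_def gen_def L_def by (rule mono_generate) blast
  have Ristn: "subgroup (Rist_pre G m \<rho> n) G"
    unfolding Rist_pre_def using rist_carrier by (intro generate_is_subgroup) blast
  have fM: "finite_index G ?M (carrier G)"
    by (rule finite_index_trans[OF MR Rist_finite_index M Ristn order_refl MR']) (simp add: n_def)
  let ?F = "?M \<inter> H"
  have F: "subgroup ?F G" by (rule subgroups_Inter_pair[OF M H])
  have fF: "finite_index G ?F H"
    by (rule finite_index_Int_self[OF finite_index_subset[OF fM subgroup.subset[OF H]] M H])
  have FP: "?F \<subseteq> generate G (gen P)"
  proof
    fix x assume x: "x \<in> ?F"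
    have split: "gen L = gen P \<union> gen (L - P)" using PL by (auto simp: gen_def)
    have comm: "s \<otimes> t = t \<otimes> s" if "s \<in> gen P" "t \<in> gen (L - P)" for s t
    proof -
      obtain u where u: "u \<in> P" "s \<in> R u" using \<open>s \<in> gen P\<close> by (auto simp: gen_def)
      obtain v where v: "v \<in> L - P" "t \<in> R v" using \<open>t \<in> gen (L - P)\<close> by (auto simp: gen_def)
      have "cone m u \<inter> cone m v = {}" using u v PL L by (intro cone_disjoint) auto
      then show ?thesis using rist_commute[of u v] u v PL L by blast
    qed
    have "?M = generate G (gen P) <#> generate G (gen (L - P))"
      unfolding split by (rule generate_Un_commuting(1)[OF genc genc]) (rule comm)
    then obtain b d where bd: "b \<in> generate G (gen P)" "d \<in> generate G (gen (L - P))" "x = b \<otimes> d"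
      using x unfolding set_mult_def by blast
    have c: "b \<in> carrier G" "d \<in> carrier G" using bd generate_in_carrier[OF genc] by auto
    have sb: "supp b \<subseteq> ?C"
    proof (rule generate_supp[OF genc _ bd(1)])
      fix a assume "a \<in> gen P"
      then obtain v where v: "v \<in> P" "a \<in> R v" by (auto simp: gen_def)
      then have "supp a \<subseteq> cone m v" using rist_iff L PL by blast
      then show "supp a \<subseteq> ?C" using v(1) by (auto simp: P_def)
    qed
    have sd: "supp d \<subseteq> boundary m - ?C"
    proof (rule generate_supp[OF genc _ bd(2)])
      fix a assume "a \<in> gen (L - P)"
      then obtain v where v: "v \<in> L - P" "a \<in> R v" by (auto simp: gen_def)
      then have "supp a \<subseteq> cone m v" using rist_iff L by auto
      then show "supp a \<subseteq> boundary m - ?C" using Ppure[OF v(1)] cone_subset_boundary by blast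
    qed
    \<comment> \<open>Both \<open>x\<close> and \<open>b\<close> are supported inside
      \<open>?C\<close>, hence so is \<open>d\<close>. But \<open>d\<close> is built from factors
      supported outside, so it is trivial.\<close>
    have "supp x \<subseteq> ?C" using x le Supp_iff by blast
    moreover have "supp (inv b \<otimes> x) \<subseteq> supp (inv b) \<union> supp x"
      using bd(3) c by (intro supp_mult) simp_all
    moreover have "d = inv b \<otimes> x" "supp (inv b) = supp b" using c bd(3) by simp_all
    ultimately have "supp d \<subseteq> ?C" using sb by blast
    then have "supp d = {}" using sd by blast
    then have "d = \<one>" using supp_empty c by blast
    then show "x \<in> generate G (gen P)" using bd c by simp
  qed
  have "derived G ?F \<subseteq> derived G (generate G (gen P))" by (rule mono_derived[OF FP])
  also have "\<dots> \<subseteq> K"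
  proof (rule derived_generate_subset[OF K(1)])
    show "gen P \<subseteq> ?N" by (auto simp: gen_def)
    fix x y assume "x \<in> gen P" "y \<in> gen P"
    then obtain u v where u: "u \<in> P" "x \<in> ?N \<inter> R u" and v: "v \<in> P" "y \<in> ?N \<inter> R v" by (auto simp: gen_def)
    have uv: "vertex m u" "vertex m v" "length u = length v" using u v PL L by auto
    show "commutator x y \<in> K"
    proof (cases "u = v")
      case True
      then show ?thesis
        using derived_le_of_moves[OF K(1) N order_refl uv(1) Pmoves[OF u(1)]] u v commutator_in_derived by blast
    next
      case False
      then have "x \<otimes> y = y \<otimes> x"
        using rist_commute[OF uv(1,2) cone_disjoint[OF uv(3) False]] u v by blast
      moreover have "x \<in> carrier G" "y \<in> carrier G" using u v rist_carrier by auto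
      ultimately have "commutator x y = \<one>" by (simp add: commutator_def m_assoc)
      then show ?thesis using subgroup.one_closed[OF K(1)] by simp
    qed
  qed
  finally show ?thesis using F fF by blast
qed

lemma StrLD:
  assumes "H \<in> StrL G"
  shows "subgroup H G" "finite_index G (normalizer G H) (carrier G)" "Supp m \<rho> H \<in> BoolB m"
proof -
  show H: "subgroup H G" and N: "finite_index G (normalizer G H) (carrier G)"
    using assms subnormal_imp_subgroup by (auto simp: StrL_def finite_index_carrier)
  show "Supp m \<rho> H \<in> BoolB m"
    by (rule Supp_clopen[OF H subgroup_normalizer[OF H] N order_refl])
qed

lemma va_leI:
  assumes "H \<in> StrL G" "K \<in> StrL G" "Supp m \<rho> H \<subseteq> Supp m \<rho> K"
  shows "va_le G (H \<inter> K) H"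
proof -
  note H = StrLD[OF assms(1)] and K = StrLD[OF assms(2)]
  obtain F where F: "subgroup F G" "F \<subseteq> H" "finite_index G F H" "derived G F \<subseteq> K"
    using derived_le_of_Supp_le[OF H(1) K(1,2) assms(3)] by blast
  have "derived G F \<subseteq> H" by (rule derived_incl[OF F(2) H(1)])
  then show ?thesis using F unfolding va_le_def finite_index_iff_rcosets by blast
qed

text \<open>Gives well-definedness and injectivity together. For the passage from virtual
  containment to supports, a point of \<open>Supp m \<rho> H\<close> outside the clopen
  \<open>Supp m \<rho> K\<close> has a small cone moved by \<open>H\<close> and disjoint from the
  latter. A nontrivial commutator of elements of \<open>F\<close> supported in that cone lies in
  \<open>K\<close>, a contradiction.\<close>

lemma va_sim_iff_Supp_eq:
  assumes H: "H \<in> StrL G" and K: "K \<in> StrL G"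
  shows "va_sim G H K \<longleftrightarrow> Supp m \<rho> H = Supp m \<rho> K"
proof
  assume "Supp m \<rho> H = Supp m \<rho> K"
  then show "va_sim G H K"
    unfolding va_sim_def using va_leI[OF H K] va_leI[OF K H] by (simp add: Int_commute)
next
  have le: "Supp m \<rho> H \<subseteq> Supp m \<rho> K"
    if H: "H \<in> StrL G" and K: "K \<in> StrL G" and va: "va_le G (H \<inter> K) H" for H K
  proof (rule ccontr)
    note SH = StrLD[OF H] and SK = StrLD[OF K]
    have Hc: "H \<subseteq> carrier G" by (rule subgroup.subset[OF SH(1)])
    have N: "subgroup (normalizer G H) G" by (rule subgroup_normalizer[OF SH(1)])
    obtain F where F: "subgroup F G" "finite_index G F H" "derived G F \<subseteq> K"
      using va unfolding va_le_def finite_index_iff_rcosets by blast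
    assume "\<not> Supp m \<rho> H \<subseteq> Supp m \<rho> K"
    then obtain f where f: "f \<in> Supp m \<rho> H" "f \<notin> Supp m \<rho> K" by blast
    then have fb: "f \<in> boundary m" by (simp add: Supp_def)
    obtain n1 where n1: "\<And>k. k \<ge> n1 \<Longrightarrow> moves H (pre f k)" using moves_Supp[OF Hc f(1)] by blast
    obtain n2 where n2: "\<And>k. k \<ge> n2 \<Longrightarrow> cone m (pre f k) \<inter> Supp m \<rho> K = {}"
      using BoolB_outside[OF SK(3) fb f(2)] by blast
    define v where "v = pre f (max n1 n2)"
    have v: "vertex m v" "moves H v" "cone m v \<inter> Supp m \<rho> K = {}"
      using fb n1 n2 by (auto simp: v_def)
    \<comment> \<open>\<open>F\<close> has finite index only in \<open>H\<close>, so the groups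
      tested against it must lie in \<open>H\<close>. \<open>R w\<close> itself need not, but these
      derived subgroups do, because \<open>H\<close> moves \<open>w\<close>.\<close>
    let ?S = "\<lambda>w. derived G (normalizer G H \<inter> R w)"
    have "\<exists>a\<in>F \<inter> ?S v. \<exists>b\<in>F \<inter> ?S v. commutator a b \<noteq> \<one>"
      using F(1,2) v(1)
    proof (rule finite_index_noncommuting)
      fix w assume w: "vertex m w" "cone m w \<subseteq> cone m v"
      have "subgroup (?S w) G" using rist_carrier by (intro derived_is_subgroup) blast
      moreover have "?S w \<subseteq> R w" by (intro derived_incl subgroup_rist w) blast
      moreover have "?S w \<subseteq> H"
        by (rule derived_le_of_moves[OF SH(1) N order_refl w(1) moves_cone[OF Hc v(1) w v(2)]])
      moreover have "?S w \<noteq> {\<one>}" by (rule derived_rist_nontrivial[OF N SH(2) w(1)])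
      ultimately show "subgroup (?S w) G \<and> ?S w \<subseteq> R w \<and> ?S w \<subseteq> H \<and> ?S w \<noteq> {\<one>}" by blast
    next
      fix u w assume "vertex m u" "vertex m w" "cone m u \<subseteq> cone m w"
      then show "?S u \<subseteq> ?S w" using rist_mono by (intro mono_derived) blast
    qed
    then obtain a b where ab: "a \<in> F" "b \<in> F" "a \<in> ?S v" "b \<in> ?S v" "commutator a b \<noteq> \<one>" by blast
    have SR: "?S v \<subseteq> R v" by (intro derived_incl subgroup_rist v) blast
    have cK: "commutator a b \<in> K" using commutator_in_derived[OF ab(1,2)] F(3) by blast
    have cR: "commutator a b \<in> R v" using ab SR by (intro supp_commutator_rist v) auto
    then have "supp (commutator a b) \<noteq> {}" using supp_empty ab(5) rist_carrier by blast
    then show False using cK cR v(3) Supp_iff rist_iff[OF v(1)] by blast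
  qed
  assume "va_sim G H K"
  then show "Supp m \<rho> H = Supp m \<rho> K"
    using le[OF H K] le[OF K H] by (auto simp: va_sim_def Int_commute)
qed

section \<open>Lattice operations and equivariance\<close>

text \<open>Near a point of both supports there is a vertex \<open>v\<close> moved by
  \<open>H\<close> and by \<open>K\<close>. With \<open>?N\<close> normalising both, the derived
  subgroup of \<open>?N \<inter> R v\<close> lies in \<open>H \<inter> K\<close> and moves a point
  in the cone of \<open>v\<close>. So \<open>Supp m \<rho> (H \<inter> K)\<close> is dense in the
  intersection, and it is closed.\<close>

lemma Supp_Int:
  assumes "H \<in> StrL G" "K \<in> StrL G"
  shows "Supp m \<rho> (H \<inter> K) = Supp m \<rho> H \<inter> Supp m \<rho> K"
proof (rule subset_antisym)
  show "Supp m \<rho> (H \<inter> K) \<subseteq> Supp m \<rho> H \<inter> Supp m \<rho> K" by (auto simp: Supp_def)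
  show "Supp m \<rho> H \<inter> Supp m \<rho> K \<subseteq> Supp m \<rho> (H \<inter> K)"
  proof (rule ccontr)
    note SH = StrLD[OF assms(1)] and SK = StrLD[OF assms(2)]
    let ?N = "normalizer G H \<inter> normalizer G K"
    have HK: "subgroup (H \<inter> K) G" by (rule subgroups_Inter_pair[OF SH(1) SK(1)])
    have NH: "subgroup (normalizer G H) G" and NK: "subgroup (normalizer G K) G"
      using subgroup_normalizer SH SK by auto
    have N: "subgroup ?N G" by (rule subgroups_Inter_pair[OF NH NK])
    have Nf: "finite_index G ?N (carrier G)" by (rule finite_index_Int[OF SH(2) SK(2) NH NK order_refl])
    have Nn: "?N \<subseteq> normalizer G (H \<inter> K)"
      using normalizer_conj[OF SH(1)] normalizer_conj[OF SK(1)] by (intro normalizerI HK N) auto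
    have C: "Supp m \<rho> (H \<inter> K) \<in> BoolB m" by (rule Supp_clopen[OF HK N Nf Nn])
    assume "\<not> ?thesis"
    then obtain f where f: "f \<in> Supp m \<rho> H" "f \<in> Supp m \<rho> K" "f \<notin> Supp m \<rho> (H \<inter> K)" by blast
    then have fb: "f \<in> boundary m" by (simp add: Supp_def)
    obtain n1 where n1: "\<And>k. k \<ge> n1 \<Longrightarrow> moves H (pre f k)"
      using moves_Supp[OF subgroup.subset[OF SH(1)] f(1)] by blast
    obtain n2 where n2: "\<And>k. k \<ge> n2 \<Longrightarrow> moves K (pre f k)"
      using moves_Supp[OF subgroup.subset[OF SK(1)] f(2)] by blast
    obtain n3 where n3: "\<And>k. k \<ge> n3 \<Longrightarrow> cone m (pre f k) \<inter> Supp m \<rho> (H \<inter> K) = {}"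
      using BoolB_outside[OF C fb f(3)] by blast
    define v where "v = pre f (max n1 (max n2 n3))"
    have v: "vertex m v" "moves H v" "moves K v" "cone m v \<inter> Supp m \<rho> (H \<inter> K) = {}"
      using fb n1 n2 n3 by (auto simp: v_def)
    let ?D = "derived G (?N \<inter> R v)"
    have "?D \<subseteq> H \<inter> K"
      using derived_le_of_moves[OF SH(1) N _ v(1,2)] derived_le_of_moves[OF SK(1) N _ v(1,3)] by blast
    moreover have DR: "?D \<subseteq> R v" by (intro derived_incl subgroup_rist v) blast
    moreover have "\<one> \<in> ?D" unfolding derived_def by (rule generate.one)
    then obtain x where x: "x \<in> ?D" "x \<noteq> \<one>" using derived_rist_nontrivial[OF N Nf v(1)] by blast
    moreover have "supp x \<noteq> {}" using x DR supp_empty rist_carrier by blast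
    ultimately show False using v(4) Supp_iff rist_iff[OF v(1)] by blast
  qed
qed

lemma Supp_generate:
  assumes "A \<subseteq> carrier G"
  shows "Supp m \<rho> (generate G A) = Supp m \<rho> A"
proof
  have "supp a \<subseteq> Supp m \<rho> A" if "a \<in> A" for a using that Supp_iff by blast
  then have "supp x \<subseteq> Supp m \<rho> A" if "x \<in> generate G A" for x
    using generate_supp[OF assms _ that] by blast
  then show "Supp m \<rho> (generate G A) \<subseteq> Supp m \<rho> A" using Supp_iff by blast
  show "Supp m \<rho> A \<subseteq> Supp m \<rho> (generate G A)" using generate.incl by (fastforce simp: Supp_iff)
qed

lemma Supp_carrier: "Supp m \<rho> (carrier G) = boundary m"
proof
  show "Supp m \<rho> (carrier G) \<subseteq> boundary m" by (auto simp: Supp_def)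
  show "boundary m \<subseteq> Supp m \<rho> (carrier G)"
  proof
    fix f assume f: "f \<in> boundary m"
    \<comment> \<open>A first step different from that of \<open>f\<close>, which exists because the
      root has at least two children.\<close>
    let ?u = "[if f 0 = 0 then 1 else 0]"
    have "pre f 1 \<in> level m 1" using f by (simp add: level_def)
    moreover have "?u \<in> level m 1"
      using m_ge2[of 0] vertex_append[of m "[]" "hd ?u"] by (auto simp: level_def)
    ultimately obtain g where g: "g \<in> carrier G" "\<rho> g (pre f 1) = ?u" using trans by blast
    then have "act g f \<noteq> f" using f pre_act[OF g(1) f, of 1] by (auto simp: pre_def split: if_splits)
    then show "f \<in> Supp m \<rho> (carrier G)" using f g by (auto simp: Supp_iff supp_iff)
  qed
qed

lemma Supp_conjg:
  assumes g: "g \<in> carrier G" and H: "H \<subseteq> carrier G"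
  shows "Supp m \<rho> (conjg G g H) = act g ` Supp m \<rho> H"
proof -
  have Un: "Supp m \<rho> A = (\<Union>h\<in>A. supp h)" for A by (auto simp: Supp_iff)
  have "Supp m \<rho> (conjg G g H) = (\<Union>h\<in>H. act g ` supp h)"
    unfolding Un conjg_def image_image using H supp_conj[OF g] by (intro SUP_cong) auto
  then show ?thesis by (simp add: Un image_UN)
qed

section \<open>The inverse map and subnormality\<close>

text \<open>Rigid stabilisers of vertices of different levels need not lie in a common level stabiliser, so
 subnormality is obtained along the chain of subgroups \<open>fixer C j\<close>, which fix the vertices up to
 level \<open>j\<close> that are not strictly below a maximal cone contained in \<open>C\<close>.\<close>

definition above_cones :: "(nat \<Rightarrow> nat) set \<Rightarrow> nat list \<Rightarrow> bool" where
  "above_cones C u \<longleftrightarrow> (\<forall>k<length u. \<not> cone m (take k u) \<subseteq> C)"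

definition fixer :: "(nat \<Rightarrow> nat) set \<Rightarrow> nat \<Rightarrow> 'a set" where
  "fixer C j = {g \<in> carrier G. \<forall>u. vertex m u \<and> length u \<le> j \<and> above_cones C u \<longrightarrow> \<rho> g u = u}"

lemma subgroup_fixer: "subgroup (fixer C j) G"
proof (rule subgroupI)
  fix a assume a: "a \<in> fixer C j"
  then show "inv a \<in> fixer C j"
    unfolding fixer_def by (auto, metis rho_inv_cancel(1))
qed (auto simp: fixer_def intro!: exI[of _ \<one>])

text \<open>\<open>above_cones\<close> restricts only proper prefixes. Those of \<open>u\<close>
  have length at most \<open>j\<close> and are fixed by \<open>inv x\<close>, so the image of
  \<open>u\<close> under \<open>inv x\<close> satisfies the condition again and is fixed by
  \<open>h\<close>.\<close>

lemma fixer_Suc_normal: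
  assumes x: "x \<in> fixer C j" and h: "h \<in> fixer C (Suc j)"
  shows "x \<otimes> h \<otimes> inv x \<in> fixer C (Suc j)"
proof -
  have c: "x \<in> carrier G" "h \<in> carrier G" using x h by (auto simp: fixer_def)
  have xi: "inv x \<in> fixer C j" by (rule subgroup.m_inv_closed[OF subgroup_fixer x])
  have "\<rho> (x \<otimes> h \<otimes> inv x) u = u" if u: "vertex m u" "length u \<le> Suc j" "above_cones C u" for u
  proof -
    let ?u = "\<rho> (inv x) u"
    have "take k ?u = take k u" if k: "k < length u" for k
    proof -
      have "above_cones C (take k u)" using u(3) by (auto simp: above_cones_def min_def)
      then have "\<rho> (inv x) (take k u) = take k u"
        using xi u k by (auto simp: fixer_def vertex_take)
      then show ?thesis using is_aut_take[OF aut u(1), of "inv x" k] c by simp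
    qed
    then have "above_cones C ?u" using u c by (simp add: above_cones_def)
    then have "\<rho> h ?u = ?u" using h u c by (auto simp: fixer_def)
    then show ?thesis using c by simp
  qed
  then show ?thesis using c by (simp add: fixer_def)
qed

lemma fixer_Suc_subset: "fixer C (Suc j) \<subseteq> fixer C j"
  by (auto simp: fixer_def)

lemma subnormal_fixer: "subnormal G (fixer C j)"
proof (induction j)
  case 0
  have "\<rho> g [] = []" if "g \<in> carrier G" for g using aut[OF that] by (simp add: is_aut_def)
  then have "fixer C 0 = carrier G" by (auto simp: fixer_def)
  then show ?case by (simp add: subnormal.top)
next
  case (Suc j)
  show ?case
    by (rule subnormal.step[OF Suc normal_in_subgroup[OF subgroup_fixer subgroup_fixer fixer_Suc_subset fixer_Suc_normal]])
qed

lemma finite_index_level_stabiliser: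
  "subgroup {g \<in> carrier G. \<forall>v\<in>level m n. \<rho> g v = v} G" (is "subgroup ?S G")
  "finite_index G {g \<in> carrier G. \<forall>v\<in>level m n. \<rho> g v = v} (carrier G)"
proof -
  show S: "subgroup ?S G"
  proof (rule subgroupI)
    fix a assume "a \<in> ?S"
    then show "inv a \<in> ?S" by (auto, metis rho_inv_cancel(1))
  qed (auto intro!: exI[of _ \<one>])
  \<comment> \<open>Inverses appear because right cosets are counted:
    \<open>x \<otimes> inv y\<close> fixes the level pointwise exactly when \<open>inv x\<close> and
    \<open>inv y\<close> agree on it.\<close>
  let ?r = "\<lambda>g. restrict (\<rho> (inv g)) (level m n)"
  have "?r ` carrier G \<subseteq> (\<Pi>\<^sub>E v\<in>level m n. level m n)"
    by (rule image_subsetI, unfold restrict_PiE_iff) (simp add: level_def)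
  then have "finite (?r ` carrier G)" using finite_PiE finite_level finite_subset by metis
  then show "finite_index G ?S (carrier G)"
    unfolding finite_index_def
  proof (rule finite_image_factor)
    fix x y assume x: "x \<in> carrier G" and y: "y \<in> carrier G" and eq: "?r x = ?r y"
    have "\<rho> (x \<otimes> inv y) v = v" if v: "v \<in> level m n" for v
    proof -
      have "\<rho> (inv x) v = \<rho> (inv y) v" using fun_cong[OF eq, of v] v by simp
      then show ?thesis using x y by (metis inv_closed rho_inv_cancel(2) rho_mult)
    qed
    then show "?S #> x = ?S #> y" using r_coset_eq_iff[OF S x y] x y by simp
  qed
qed

lemma finite_index_fixer: "finite_index G (fixer C j) (carrier G)"
proof (rule finite_index_mono[OF finite_index_level_stabiliser(2)[of j]])
  show "{g \<in> carrier G. \<forall>v\<in>level m j. \<rho> g v = v} \<subseteq> fixer C j"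
  proof clarify
    fix g assume g: "g \<in> carrier G" "\<forall>v\<in>level m j. \<rho> g v = v"
    have "\<rho> g u = u" if u: "vertex m u" "length u \<le> j" for u
    proof -
      obtain f where f: "f \<in> boundary m" "pre f (length u) = u" using vertex_eq_pre[OF u(1)] by blast
      then have "\<rho> g (pre f j) = pre f j" using g by (simp add: level_def)
      then have "\<rho> g (take (length u) (pre f j)) = take (length u) (pre f j)"
        using is_aut_take[OF aut[OF g(1)] vertex_pre[OF f(1)]] by simp
      then show ?thesis using f u by (simp add: take_pre min_absorb1)
    qed
    then show "g \<in> fixer C j" using g by (simp add: fixer_def)
  qed
qed (use finite_index_level_stabiliser(1) subgroup_fixer in auto)

text \<open>With \<open>n\<close> a level at which no cone straddles \<open>C\<close>, the group
  \<open>fixer C n\<close> contains the generated group and preserves \<open>C\<close>. It therefore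
  permutes the generating rigid stabilisers by conjugation, which yields both subnormality and a
  normaliser of finite index.\<close>

lemma PhiInv_StrL:
  assumes C: "C \<in> BoolB m"
  shows "PhiInv G m \<rho> C \<in> StrL G" and "Supp m \<rho> (PhiInv G m \<rho> C) = C"
proof -
  let ?A = "\<Union>v\<in>{v \<in> vertices m. cone m v \<subseteq> C}. R v" and ?P = "PhiInv G m \<rho> C"
  have Ac: "?A \<subseteq> carrier G" using rist_carrier by blast
  have PA: "?P = generate G ?A" by (simp add: PhiInv_def)
  have P: "subgroup ?P G" unfolding PA by (rule generate_is_subgroup[OF Ac])
  obtain n where n: "\<And>f. f \<in> boundary m \<Longrightarrow> cone m (pre f n) \<subseteq> C \<or> cone m (pre f n) \<inter> C = {}"
    using clopen_pure[OF C] by blast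
  let ?D = "fixer C n"
  have D: "subgroup ?D G" by (rule subgroup_fixer)
  have Cb: "C \<subseteq> boundary m" using C by (auto simp: BoolB_def bd_open_def)
  have PD: "?P \<subseteq> ?D"
    unfolding PA
  proof (rule generate_subgroup_incl[OF _ D], clarify)
    fix v g assume v: "v \<in> vertices m" "cone m v \<subseteq> C" and g: "g \<in> R v"
    have vv: "vertex m v" using v by (simp add: vertices_def)
    have gc: "g \<in> carrier G" "supp g \<subseteq> cone m v" "\<rho> g v = v" using g rist_iff[OF vv] supp_cone_fix[OF _ vv] by auto
    \<comment> \<open>Cones are disjoint or nested. If \<open>u\<close> is a prefix of
      \<open>v\<close>, it is fixed along with \<open>v\<close>; \<open>v\<close> cannot be a proper
      prefix of \<open>u\<close>, since its cone lies in \<open>C\<close> and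
      \<open>above_cones\<close> forbids this.\<close>
    have "\<rho> g u = u" if u: "vertex m u" "above_cones C u" for u
    proof (cases "cone m u \<inter> cone m v = {}")
      case True
      obtain f where f: "f \<in> boundary m" "pre f (length u) = u" using vertex_eq_pre[OF u(1)] by blast
      then have "f \<notin> supp g" using gc True by (auto simp: cone_def)
      then have "act g f = f" using f by (simp add: supp_iff)
      then show ?thesis using pre_act[OF gc(1) f(1), of "length u"] f by simp
    next
      case False
      then obtain f where f: "f \<in> boundary m" "pre f (length u) = u" "pre f (length v) = v"
        by (auto simp: cone_def)
      show ?thesis
      proof (cases "length u \<le> length v")
        case True
        then have "take (length u) v = u" using f take_pre[of "length u" f "length v"] by (simp add: min_absorb1)
        then show ?thesis using is_aut_take[OF aut[OF gc(1)] vv, of "length u"] gc by simp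
      next
        case False
        then have "take (length v) u = v" using f take_pre[of "length v" f "length u"] by (simp add: min_absorb1)
        then show ?thesis using u(2) False v(2) by (metis above_cones_def not_le)
      qed
    qed
    then show "g \<in> ?D" using gc by (simp add: fixer_def)
  qed
  have DC: "act x f \<in> C" if x: "x \<in> ?D" and f: "f \<in> C" for x f
  proof -
    have xc: "x \<in> carrier G" using x by (simp add: fixer_def)
    have fb: "f \<in> boundary m" using f Cb by blast
    then have ex: "cone m (pre f n) \<subseteq> C" using n f cone_pre by blast
    \<comment> \<open>The prefix of length \<open>k\<close> spans the largest cone around
      \<open>f\<close> inside \<open>C\<close>. Minimality gives \<open>above_cones\<close>, and
      purity gives \<open>k \<le> n\<close>, so \<open>x\<close> fixes this prefix and keeps
      \<open>f\<close> within the cone.\<close>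
    define k where "k = (LEAST k. cone m (pre f k) \<subseteq> C)"
    have k: "cone m (pre f k) \<subseteq> C" unfolding k_def by (rule LeastI[of "\<lambda>k. cone m (pre f k) \<subseteq> C", OF ex])
    have kn: "k \<le> n" unfolding k_def by (rule Least_le[of "\<lambda>k. cone m (pre f k) \<subseteq> C", OF ex])
    have "above_cones C (pre f k)"
      unfolding above_cones_def
    proof (intro allI impI)
      fix i assume "i < length (pre f k)"
      then have i: "i < k" by simp
      then have "\<not> cone m (pre f i) \<subseteq> C" unfolding k_def by (rule not_less_Least)
      then show "\<not> cone m (take i (pre f k)) \<subseteq> C" using i by (simp add: take_pre min_absorb1)
    qed
    then have "\<rho> x (pre f k) = pre f k" using x kn fb by (simp add: fixer_def)
    then have "act x f \<in> cone m (pre f k)" using act_cone_iff[OF xc fb vertex_pre[OF fb], of k] cone_pre[OF fb] by simp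
    then show ?thesis using k by blast
  qed
  have conj: "x \<otimes> h \<otimes> inv x \<in> ?P" if x: "x \<in> ?D" and h: "h \<in> ?P" for x h
  proof -
    have xc: "x \<in> carrier G" using x by (simp add: fixer_def)
    show ?thesis
      unfolding PA using Ac xc
    proof (rule generate_conj)
      show "h \<in> generate G ?A" using h by (simp add: PA)
      fix s assume "s \<in> ?A"
      then obtain v where v: "vertex m v" "cone m v \<subseteq> C" "s \<in> R v" by (auto simp: vertices_def)
      have "cone m (\<rho> x v) \<subseteq> C"
      proof
        fix f assume f: "f \<in> cone m (\<rho> x v)"
        then have fb: "f \<in> boundary m" by (simp add: cone_def)
        have "act (inv x) f \<in> cone m v"
          using f fb xc v act_cone_iff[OF xc, of "act (inv x) f" v] by simp
        then have "act x (act (inv x) f) \<in> C" using DC[OF x] v by blast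
        then show "f \<in> C" using xc fb by simp
      qed
      moreover have "x \<otimes> s \<otimes> inv x \<in> R (\<rho> x v)" by (rule rist_conj[OF v(1) xc v(3)])
      ultimately show "x \<otimes> s \<otimes> inv x \<in> generate G ?A"
        using v xc by (intro generate.incl UN_I[of "\<rho> x v"]) (simp_all add: vertices_def)
    qed
  qed
  have "subnormal G ?P"
    by (rule subnormal.step[OF subnormal_fixer normal_in_subgroup[OF D P PD conj]])
  moreover have Nf: "finite_index G (normalizer G ?P) (carrier G)"
    by (rule finite_index_mono[OF finite_index_fixer normalizerI[OF P D conj] D subgroup_normalizer[OF P] order_refl])
  ultimately show "?P \<in> StrL G" by (simp add: StrL_def finite_index_carrier)
  have clopen: "Supp m \<rho> ?P \<in> BoolB m" by (rule Supp_clopen[OF P subgroup_normalizer[OF P] Nf order_refl])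
  show "Supp m \<rho> ?P = C"
  proof
    have "supp a \<subseteq> C" if a: "a \<in> ?A" for a
    proof -
      obtain v where v: "vertex m v" "cone m v \<subseteq> C" "a \<in> R v" using a by (auto simp: vertices_def)
      then show ?thesis using rist_iff[OF v(1)] by blast
    qed
    then have "supp x \<subseteq> C" if "x \<in> ?P" for x
      using generate_supp[OF Ac _ that[unfolded PA]] by blast
    then show "Supp m \<rho> ?P \<subseteq> C" using Supp_iff by blast
    \<comment> \<open>A point of \<open>C\<close> outside the clopen support would have a cone
      inside \<open>C\<close> that misses the support, yet the rigid stabiliser of that cone is
      nontrivial and belongs to \<open>?P\<close>.\<close>
    show "C \<subseteq> Supp m \<rho> ?P"
    proof
      fix f assume f: "f \<in> C"
      then have fb: "f \<in> boundary m" using Cb by blast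
      show "f \<in> Supp m \<rho> ?P"
      proof (rule ccontr)
        assume "f \<notin> Supp m \<rho> ?P"
        then obtain k1 where k1: "\<And>k. k \<ge> k1 \<Longrightarrow> cone m (pre f k) \<inter> Supp m \<rho> ?P = {}"
          using BoolB_outside[OF clopen fb] by blast
        obtain k2 where k2: "\<And>k. k \<ge> k2 \<Longrightarrow> cone m (pre f k) \<subseteq> C"
          using BoolB_inside[OF C f] by blast
        define v where "v = pre f (max k1 k2)"
        have v: "vertex m v" "cone m v \<inter> Supp m \<rho> ?P = {}" "cone m v \<subseteq> C"
          using k1 k2 fb by (auto simp: v_def)
        obtain g where g: "g \<in> R v" "g \<noteq> \<one>" using rist_nontrivial[OF v(1)] by blast
        have "g \<in> ?P" unfolding PA using g v by (intro generate.incl UN_I[of v]) (simp_all add: vertices_def)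
        moreover have "supp g \<noteq> {}" "supp g \<subseteq> cone m v" using g supp_empty rist_iff[OF v(1)] by auto
        ultimately show False using v(2) Supp_iff by blast
      qed
    qed
  qed
qed

end

theorem theoremA:
  fixes G :: "('a, 'b) monoid_scheme" and m :: "nat \<Rightarrow> nat"
    and \<rho> :: "'a \<Rightarrow> nat list \<Rightarrow> nat list"
  assumes "group G" and "\<forall>i. 2 \<le> m i" and "branch_action G m \<rho>"
  shows
    "(\<forall>H\<in>StrL G. Supp m \<rho> H \<in> BoolB m)
   \<and> (\<forall>H\<in>StrL G. \<forall>K\<in>StrL G. va_sim G H K \<longrightarrow> Supp m \<rho> H = Supp m \<rho> K)
   \<and> (\<forall>H\<in>StrL G. \<forall>K\<in>StrL G. Supp m \<rho> H = Supp m \<rho> K \<longrightarrow> va_sim G H K)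
   \<and> (\<forall>H\<in>StrL G. \<forall>K\<in>StrL G. Supp m \<rho> (H \<inter> K) = Supp m \<rho> H \<inter> Supp m \<rho> K)
   \<and> (\<forall>H\<in>StrL G. \<forall>K\<in>StrL G. Supp m \<rho> (generate G (H \<union> K)) = Supp m \<rho> H \<union> Supp m \<rho> K)
   \<and> Supp m \<rho> {\<one>\<^bsub>G\<^esub>} = {}
   \<and> Supp m \<rho> (carrier G) = boundary m
   \<and> (\<forall>g\<in>carrier G. \<forall>H\<in>StrL G. Supp m \<rho> (conjg G g H) = bnd_act (\<rho> g) ` Supp m \<rho> H)
   \<and> (\<forall>C\<in>BoolB m. PhiInv G m \<rho> C \<in> StrL G \<and> Supp m \<rho> (PhiInv G m \<rho> C) = C)
   \<and> (\<forall>H\<in>StrL G. va_sim G (PhiInv G m \<rho> (Supp m \<rho> H)) H)"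
proof -
  interpret group G by fact
  interpret branch_group G m \<rho>
    using assms(2,3) by unfold_locales (auto simp: branch_action_def finite_index_carrier)
  have sub: "H \<subseteq> carrier G" if "H \<in> StrL G" for H
    using StrLD(1)[OF that] subgroup.subset by blast
  have join: "Supp m \<rho> (generate G (H \<union> K)) = Supp m \<rho> H \<union> Supp m \<rho> K"
    if "H \<in> StrL G" "K \<in> StrL G" for H K
    using Supp_generate[of "H \<union> K"] sub that by (auto simp: Supp_def)
  have bottom: "Supp m \<rho> {\<one>\<^bsub>G\<^esub>} = {}" using Supp_iff by auto
  have inverse: "va_sim G (PhiInv G m \<rho> (Supp m \<rho> H)) H" if H: "H \<in> StrL G" for H
    using va_sim_iff_Supp_eq[OF PhiInv_StrL(1) H] PhiInv_StrL(2) StrLD(3)[OF H] by simp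
  show ?thesis
    by (intro conjI ballI impI)
       (simp_all add: StrLD(3) va_sim_iff_Supp_eq Supp_Int join bottom Supp_carrier Supp_conjg sub
          PhiInv_StrL inverse)
qed

end
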